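(* Let $N\ge1$ and let $\{\psi_j\}_{j=1}^N\subset H^1(\mathbb{T}^2)$ be a family of real-valued scalar functions that is orthonormal in $L_2(\mathbb{T}^2)$ and such that each function has zero average: $\int_{\mathbb{T}^2}\psi_j(x)\,dx=0$ for $j=1,\dots,N$. Then $\rho(x):=\sum_{j=1}^N\psi_j(x)^2$ satisfies the inequality $$ \int_{\mathbb{T}^2}\rho(x)^2\,dx\le\frac{6}{\pi^2}\sum_{j=1}^N\|\nabla\psi_j\|^2 . $$
   Context: $\mathbb{T}^2=[0,2\pi]^2$ is the flat square two-dimensional torus (functions on it are $2\pi$-periodic in each coordinate), with Lebesgue measure $dx$ (total measure $4\pi^2$). $H^1(\mathbb{T}^2)$ is the Sobolev space of periodic functions, and $\|\cdot\|$ is the $L_2$ norm over $\mathbb{T}^2$. *)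

theory Defs
  imports "HOL-Analysis.Analysis"
begin

text \<open>Functions on the torus are \<open>2\<pi>\<close>-periodic functions on the plane, integrated over the
  fundamental cell with Lebesgue measure.\<close>

definition torus :: "(real ^ 2) measure" where
  "torus = lebesgue_on (cbox 0 (\<chi> i. 2 * pi))"

definition periodic :: "(real ^ 2 \<Rightarrow> 'a) \<Rightarrow> bool" where
  "periodic f \<longleftrightarrow> (\<forall>x i. f (x + axis i (2 * pi)) = f x)"

definition L2_torus :: "(real ^ 2 \<Rightarrow> 'a::euclidean_space) set" where
  "L2_torus = {f. periodic f \<and> f \<in> borel_measurable torus \<and> integrable torus (\<lambda>x. (norm (f x))\<^sup>2)}"

definition L2_inner :: "(real ^ 2 \<Rightarrow> 'a::euclidean_space) \<Rightarrow> (real ^ 2 \<Rightarrow> 'a) \<Rightarrow> real" where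
  "L2_inner f g = (\<integral>x. f x \<bullet> g x \<partial>torus)"

definition L2_norm :: "(real ^ 2 \<Rightarrow> 'a::euclidean_space) \<Rightarrow> real" where
  "L2_norm f = sqrt (L2_inner f f)"

definition partial_deriv :: "2 \<Rightarrow> (real ^ 2 \<Rightarrow> real) \<Rightarrow> real ^ 2 \<Rightarrow> real" where
  "partial_deriv i f x = frechet_derivative f (at x) (axis i 1)"

primrec Ck :: "nat \<Rightarrow> (real ^ 2 \<Rightarrow> real) \<Rightarrow> bool" where
  "Ck 0 f \<longleftrightarrow> continuous_on UNIV f"
| "Ck (Suc k) f \<longleftrightarrow> (\<forall>x. f differentiable (at x)) \<and> (\<forall>i. Ck k (partial_deriv i f))"

definition smooth_torus :: "(real ^ 2 \<Rightarrow> real) set" where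
  "smooth_torus = {\<phi>. periodic \<phi> \<and> (\<forall>k. Ck k \<phi>)}"

text \<open>The test functions are periodic rather than compactly supported in the open cell: this is
  what rules out jumps across the boundary of the cell.\<close>

definition has_weak_gradient :: "(real ^ 2 \<Rightarrow> real) \<Rightarrow> (real ^ 2 \<Rightarrow> real ^ 2) \<Rightarrow> bool" where
  "has_weak_gradient f g \<longleftrightarrow>
    (\<forall>\<phi>\<in>smooth_torus. \<forall>i.
      (\<integral>x. f x * partial_deriv i \<phi> x \<partial>torus) = - (\<integral>x. g x $ i * \<phi> x \<partial>torus))"

definition H1_torus :: "(real ^ 2 \<Rightarrow> real) set" where
  "H1_torus = {f \<in> L2_torus. \<exists>g\<in>L2_torus. has_weak_gradient f g}"

text \<open>The weak gradient is determined only up to null sets, so only quantities invariant under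
  almost everywhere equality, such as its \<open>L\<^sub>2\<close> norm, are meaningful.\<close>

definition weak_gradient :: "(real ^ 2 \<Rightarrow> real) \<Rightarrow> real ^ 2 \<Rightarrow> real ^ 2" where
  "weak_gradient f = (SOME g. g \<in> L2_torus \<and> has_weak_gradient f g)"

end

theory Submission
  imports Defs
begin

text \<open>
  The proof follows Rumin's method: split the functions into low and high frequencies at a variable
  threshold, bound the low part pointwise and integrate the high part over all thresholds.

  Let \<open>e\<^sub>k\<close>, \<open>k \<in> \<int>\<^sup>2\<close>, be a real orthonormal basis of \<open>L\<^sub>2\<close> of the torus consisting of trigonometric
  functions of frequency \<open>k\<close>, and let \<open>c\<^sub>j\<^sub>k\<close> be the coefficients of \<open>\<psi>\<^sub>j\<close>. Write \<open>low n j\<close> for the part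
  of \<open>\<psi>\<^sub>j\<close> with \<open>0 < \<bar>k\<bar>\<^sup>2 \<le> n\<close>. For fixed \<open>x\<close>, Bessel's inequality for the orthonormal family
  \<open>\<psi>\<^sub>1, \<dots>, \<psi>\<^sub>N\<close>, applied to the kernel \<open>\<Sum>\<^sub>k e\<^sub>k(x) e\<^sub>k\<close>, gives \<open>\<Sum>\<^sub>j (low n j x)\<^sup>2 \<le> \<Sum>\<^sub>k e\<^sub>k(x)\<^sup>2\<close>
  (lemma \<open>sum_square_projections_le\<close>). The right-hand side is the number of nonzero lattice points in
  the disc of radius \<open>\<surd>n\<close>, divided by \<open>4 \<pi>\<^sup>2\<close>. That number is at most \<open>4 n\<close> (lemma
  \<open>card_int_disc_le\<close>), and this lattice point bound is where the constant of the theorem comes from.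
  Since the averages vanish, the frequency \<open>0\<close>, for which no such bound would hold, never enters.

  By the triangle inequality in \<open>\<real>\<^sup>N\<close>, the high part \<open>high n x = \<Sum>\<^sub>j (\<psi>\<^sub>j x - low n j x)\<^sup>2\<close> satisfies
  \<open>high n x \<ge> (\<surd>(\<rho> x) - \<surd>n / \<pi>)\<^sub>+\<^sup>2\<close>. Comparing the sum over \<open>n\<close> with an integral (lemma
  \<open>fourth_power_le_sum_square_gaps\<close>) yields \<open>\<Sum>\<^sub>n high n x \<ge> \<pi>\<^sup>2 (\<rho> x)\<^sup>2 / 6\<close>. On the other hand, by
  Parseval's identity, each coefficient \<open>c\<^sub>j\<^sub>k\<close> is counted in \<open>\<integral> high n\<close> for exactly the \<open>\<bar>k\<bar>\<^sup>2\<close> values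
  \<open>n < \<bar>k\<bar>\<^sup>2\<close>, so that \<open>\<Sum>\<^sub>n \<integral> high n = \<Sum>\<^sub>j \<Sum>\<^sub>k \<bar>k\<bar>\<^sup>2 c\<^sub>j\<^sub>k\<^sup>2 \<le> \<Sum>\<^sub>j \<parallel>\<nabla>\<psi>\<^sub>j\<parallel>\<^sup>2\<close>; see
  \<open>sum_remainders_le\<close>. Integrating the pointwise bound gives the theorem, and integrability of
  \<open>\<rho>\<^sup>2\<close> along with it.

  The analytic input is the completeness of the trigonometric system (lemma \<open>hartley_complete\<close>),
  which comes from the Stone-Weierstrass theorem on the torus embedded in \<open>\<complex>\<^sup>2\<close>.
\<close>

section \<open>Square integrable functions and finite orthonormal families\<close>

definition square_integrable :: "'a measure \<Rightarrow> ('a \<Rightarrow> real) \<Rightarrow> bool" where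
  "square_integrable M f \<longleftrightarrow> f \<in> borel_measurable M \<and> integrable M (\<lambda>x. (f x)\<^sup>2)"

lemma square_integrable_mult:
  assumes "square_integrable M f" "square_integrable M g"
  shows "integrable M (\<lambda>x. f x * g x)"
proof (rule Bochner_Integration.integrable_bound)
  show "integrable M (\<lambda>x. (f x)\<^sup>2 + (g x)\<^sup>2)"
    using assms by (simp add: square_integrable_def)
  show "(\<lambda>x. f x * g x) \<in> borel_measurable M"
    using assms by (auto simp: square_integrable_def)
  have "\<bar>a * b\<bar> \<le> a\<^sup>2 + b\<^sup>2" for a b :: real
  proof -
    have "2 * (a * b) \<le> a\<^sup>2 + b\<^sup>2" by (rule sum_squares_bound[of a b, simplified mult.assoc])
    moreover have "- (2 * (a * b)) \<le> a\<^sup>2 + b\<^sup>2" using sum_squares_bound[of a "-b"] by simp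
    moreover have "0 \<le> a\<^sup>2 + b\<^sup>2" by simp
    ultimately show ?thesis by linarith
  qed
  then show "AE x in M. norm (f x * g x) \<le> norm ((f x)\<^sup>2 + (g x)\<^sup>2)"
    by simp
qed

lemma square_integrable_cmult:
  "square_integrable M f \<Longrightarrow> square_integrable M (\<lambda>x. c * f x)"
  by (auto simp: square_integrable_def power_mult_distrib)

lemma square_integrable_add:
  assumes "square_integrable M f" "square_integrable M g"
  shows "square_integrable M (\<lambda>x. f x + g x)"
  using assms square_integrable_mult[OF assms]
  by (auto simp: square_integrable_def power2_sum mult.assoc)

lemma square_integrable_diff:
  assumes "square_integrable M f" "square_integrable M g"
  shows "square_integrable M (\<lambda>x. f x - g x)"
  using square_integrable_add[OF assms(1) square_integrable_cmult[OF assms(2), of "-1"]] by simp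

lemma square_integrable_sum:
  "(\<And>k. k \<in> A \<Longrightarrow> square_integrable M (f k)) \<Longrightarrow> square_integrable M (\<lambda>x. \<Sum>k\<in>A. f k x)"
  by (induction A rule: infinite_finite_induct)
     (simp_all add: square_integrable_add, simp_all add: square_integrable_def)

definition orthonormal_on :: "'a measure \<Rightarrow> 'k set \<Rightarrow> ('k \<Rightarrow> 'a \<Rightarrow> real) \<Rightarrow> bool" where
  "orthonormal_on M A e \<longleftrightarrow> (\<forall>k\<in>A. square_integrable M (e k)) \<and>
     (\<forall>k\<in>A. \<forall>l\<in>A. (\<integral>x. e k x * e l x \<partial>M) = (if k = l then 1 else 0))"

lemma orthonormal_on_subset: "orthonormal_on M B e \<Longrightarrow> A \<subseteq> B \<Longrightarrow> orthonormal_on M A e"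
  unfolding orthonormal_on_def by blast

text \<open>
  Expanding the square and completing it in each coefficient \<open>a k\<close>. The remainder formula, Bessel's
  inequality and the optimality of Fourier coefficients among all coefficients are read off from this
  one identity.
\<close>

lemma integral_square_diff_orthonormal:
  assumes A: "finite A" and e: "orthonormal_on M A e" and f: "square_integrable M f"
  shows "(\<integral>x. (f x - (\<Sum>k\<in>A. a k * e k x))\<^sup>2 \<partial>M) =
    (\<integral>x. (f x)\<^sup>2 \<partial>M) - (\<Sum>k\<in>A. (\<integral>x. f x * e k x \<partial>M)\<^sup>2)
      + (\<Sum>k\<in>A. (a k - (\<integral>x. f x * e k x \<partial>M))\<^sup>2)"
proof -
  define c where "c k = (\<integral>x. f x * e k x \<partial>M)" for k
  define p where "p x = (\<Sum>k\<in>A. a k * e k x)" for x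
  have e2: "square_integrable M (e k)" if "k \<in> A" for k
    using e that by (simp add: orthonormal_on_def)
  have p: "square_integrable M p"
    unfolding p_def by (intro square_integrable_sum square_integrable_cmult e2)
  have against_p: "(\<integral>x. g x * p x \<partial>M) = (\<Sum>k\<in>A. a k * (\<integral>x. g x * e k x \<partial>M))"
    if g: "square_integrable M g" for g
  proof -
    have "(\<integral>x. g x * p x \<partial>M) = (\<integral>x. (\<Sum>k\<in>A. a k * (g x * e k x)) \<partial>M)"
      by (simp add: p_def sum_distrib_left mult_ac)
    also have "\<dots> = (\<Sum>k\<in>A. \<integral>x. a k * (g x * e k x) \<partial>M)"
      by (intro Bochner_Integration.integral_sum integrable_mult_right square_integrable_mult g e2)
    finally show ?thesis by simp
  qed
  have pe: "(\<integral>x. p x * e k x \<partial>M) = a k" if k: "k \<in> A" for k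
  proof -
    have "(\<integral>x. p x * e k x \<partial>M) = (\<integral>x. e k x * p x \<partial>M)" by (simp add: mult.commute)
    also have "\<dots> = (\<Sum>l\<in>A. a l * (if k = l then 1 else 0))"
      unfolding against_p[OF e2[OF k]]
      by (rule sum.cong) (use e k in \<open>auto simp: orthonormal_on_def\<close>)
    also have "\<dots> = a k" using A k by (simp add: if_distrib cong: if_cong)
    finally show ?thesis .
  qed
  have "(\<integral>x. (f x - p x)\<^sup>2 \<partial>M) = (\<integral>x. (f x)\<^sup>2 - 2 * (f x * p x) + p x * p x \<partial>M)"
    by (simp add: power2_eq_square algebra_simps)
  also have "\<dots> = (\<integral>x. (f x)\<^sup>2 \<partial>M) - 2 * (\<integral>x. f x * p x \<partial>M) + (\<integral>x. p x * p x \<partial>M)"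
    using f square_integrable_mult[OF f p] square_integrable_mult[OF p p]
    by (simp add: square_integrable_def)
  also have "\<dots> = (\<integral>x. (f x)\<^sup>2 \<partial>M) - 2 * (\<Sum>k\<in>A. a k * c k) + (\<Sum>k\<in>A. a k * a k)"
    by (simp add: against_p f p c_def pe cong: sum.cong)
  also have "\<dots> = (\<integral>x. (f x)\<^sup>2 \<partial>M) - (\<Sum>k\<in>A. (c k)\<^sup>2) + (\<Sum>k\<in>A. (a k - c k)\<^sup>2)"
    by (simp add: power2_eq_square algebra_simps sum.distrib sum_subtractf sum_distrib_left)
  finally show ?thesis by (simp add: p_def c_def)
qed

lemma integral_square_remainder:
  assumes "finite A" "orthonormal_on M A e" "square_integrable M f"
  shows "(\<integral>x. (f x - (\<Sum>k\<in>A. (\<integral>y. f y * e k y \<partial>M) * e k x))\<^sup>2 \<partial>M) =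
    (\<integral>x. (f x)\<^sup>2 \<partial>M) - (\<Sum>k\<in>A. (\<integral>x. f x * e k x \<partial>M)\<^sup>2)"
  using integral_square_diff_orthonormal[OF assms, of "\<lambda>k. \<integral>y. f y * e k y \<partial>M"] by simp

lemma Bessel_inequality:
  assumes "finite A" "orthonormal_on M A e" "square_integrable M f"
  shows "(\<Sum>k\<in>A. (\<integral>x. f x * e k x \<partial>M)\<^sup>2) \<le> (\<integral>x. (f x)\<^sup>2 \<partial>M)"
proof -
  have "0 \<le> (\<integral>x. (f x - (\<Sum>k\<in>A. (\<integral>y. f y * e k y \<partial>M) * e k x))\<^sup>2 \<partial>M)"
    by simp
  then show ?thesis unfolding integral_square_remainder[OF assms] by simp
qed

lemma integral_square_sum_orthonormal:
  assumes "finite A" "orthonormal_on M A e"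
  shows "(\<integral>x. (\<Sum>k\<in>A. a k * e k x)\<^sup>2 \<partial>M) = (\<Sum>k\<in>A. (a k)\<^sup>2)"
  using integral_square_diff_orthonormal[OF assms, of "\<lambda>_. 0" a]
  by (simp add: square_integrable_def)

text \<open>
  Two orthonormal families enter symmetrically in the coefficients \<open>\<integral> u j * e k\<close>. For fixed \<open>x\<close> the
  inner sum is therefore also the coefficient at \<open>u j\<close> of the function \<open>\<Sum>k\<in>A. e k x * e k\<close>, and
  Bessel's inequality for \<open>u\<close> applies to that function. The bound does not depend on the number of
  functions \<open>u j\<close>, which is the reason why orthonormality helps.
\<close>

lemma sum_square_projections_le:
  assumes A: "finite A" "orthonormal_on M A e" and J: "finite J" "orthonormal_on M J u"
  shows "(\<Sum>j\<in>J. (\<Sum>k\<in>A. (\<integral>y. u j y * e k y \<partial>M) * e k x)\<^sup>2) \<le> (\<Sum>k\<in>A. (e k x)\<^sup>2)"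
proof -
  define F where "F y = (\<Sum>k\<in>A. e k x * e k y)" for y
  have e2: "square_integrable M (e k)" if "k \<in> A" for k
    using A that by (simp add: orthonormal_on_def)
  have u2: "square_integrable M (u j)" if "j \<in> J" for j
    using J that by (simp add: orthonormal_on_def)
  have F: "square_integrable M F"
    unfolding F_def by (intro square_integrable_sum square_integrable_cmult e2)
  have "(\<integral>y. F y * u j y \<partial>M) = (\<Sum>k\<in>A. (\<integral>y. u j y * e k y \<partial>M) * e k x)" if j: "j \<in> J" for j
  proof -
    have "(\<integral>y. F y * u j y \<partial>M) = (\<integral>y. (\<Sum>k\<in>A. e k x * (u j y * e k y)) \<partial>M)"
      by (simp add: F_def sum_distrib_left sum_distrib_right mult_ac)
    also have "\<dots> = (\<Sum>k\<in>A. \<integral>y. e k x * (u j y * e k y) \<partial>M)"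
      by (intro Bochner_Integration.integral_sum integrable_mult_right square_integrable_mult e2 u2 j)
    finally show ?thesis by (simp add: mult.commute)
  qed
  then have "(\<Sum>j\<in>J. (\<Sum>k\<in>A. (\<integral>y. u j y * e k y \<partial>M) * e k x)\<^sup>2)
      = (\<Sum>j\<in>J. (\<integral>y. F y * u j y \<partial>M)\<^sup>2)"
    by simp
  also have "\<dots> \<le> (\<integral>y. (F y)\<^sup>2 \<partial>M)"
    by (rule Bessel_inequality[OF J F])
  also have "\<dots> = (\<Sum>k\<in>A. (e k x)\<^sup>2)"
    unfolding F_def by (rule integral_square_sum_orthonormal[OF A])
  finally show ?thesis .
qed

section \<open>The Hartley basis of the torus\<close>

text \<open>
  Lebesgue measure on a Euclidean space is the image of the product of one-dimensional Lebesgue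
  measures over the basis, so Fubini's theorem for finite products applies.
\<close>

lemma integral_lborel_prod:
  fixes f :: "'a::euclidean_space \<Rightarrow> real \<Rightarrow> complex"
  assumes "\<And>b. b \<in> Basis \<Longrightarrow> integrable lborel (f b)"
  shows "(\<integral>x. (\<Prod>b\<in>Basis. f b (x \<bullet> b)) \<partial>(lborel :: 'a measure)) = (\<Prod>b\<in>Basis. \<integral>y. f b y \<partial>lborel)"
proof -
  interpret product_sigma_finite "\<lambda>_::'a. lborel :: real measure" ..
  have m: "f b \<in> borel_measurable borel" if "b \<in> Basis" for b
    using borel_measurable_integrable[OF assms[OF that]] by simp
  have "(\<integral>x. (\<Prod>b\<in>Basis. f b (x \<bullet> b)) \<partial>(lborel :: 'a measure))
      = (\<integral>y. (\<Prod>b\<in>Basis. f b ((\<Sum>i\<in>Basis. y i *\<^sub>R i) \<bullet> b)) \<partial>(\<Pi>\<^sub>M b\<in>(Basis::'a set). lborel))"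
    by (subst lborel_eq, subst integral_distr)
       (auto intro!: borel_measurable_prod measurable_compose[OF _ m])
  also have "\<dots> = (\<integral>y. (\<Prod>b\<in>Basis. f b (y b)) \<partial>(\<Pi>\<^sub>M b\<in>(Basis::'a set). lborel))"
    by (intro Bochner_Integration.integral_cong prod.cong refl) (simp add: inner_sum_left inner_Basis if_distrib cong: if_cong)
  also have "\<dots> = (\<Prod>b\<in>Basis. \<integral>y. f b y \<partial>lborel)"
    by (rule product_integral_prod) (use assms in auto)
  finally show ?thesis .
qed

lemma integral_cis_period:
  "(\<integral>y. indicator {0..2*pi} y *\<^sub>R cis (of_int m * y) \<partial>lborel) = (if m = 0 then 2 * pi else 0)"
    (is ?eq)
  and integrable_cis_period: "integrable lborel (\<lambda>y. indicator {0..2*pi} y *\<^sub>R cis (of_int m * y))"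
proof -
  show "integrable lborel (\<lambda>y. indicator {0..2*pi} y *\<^sub>R cis (of_int m * y))"
    using borel_integrable_compact[of "{0..2*pi}" "\<lambda>y. cis (of_int m * y)"]
    by (simp add: continuous_intros)
  show ?eq
  proof (cases "m = 0")
    case True then show ?thesis by (simp add: scaleR_conv_of_real)
  next
    case False
    have "(\<integral>y. indicator {0..2*pi} y *\<^sub>R cis (of_int m * y) \<partial>lborel)
        = cis (of_int m * (2*pi)) / (\<i> * of_int m) - cis (of_int m * 0) / (\<i> * of_int m)"
    proof (rule integral_FTC_Icc)
      fix x :: real
      have "((\<lambda>z. exp (\<i> * of_int m * z) / (\<i> * of_int m)) has_field_derivative
              exp (\<i> * of_int m * of_real x)) (at (of_real x))"
        using False by (auto intro!: derivative_eq_intros)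
      from has_vector_derivative_real_field[OF this]
      show "((\<lambda>y. cis (of_int m * y) / (\<i> * of_int m)) has_vector_derivative cis (of_int m * x))
              (at x within {0..2*pi})"
        by (simp add: cis_conv_exp mult.assoc)
    qed (auto intro!: continuous_intros)
    also have "cis (of_int m * (2*pi)) = 1"
      by (metis cis_multiple_2pi Ints_of_int mult.commute mult.left_commute)
    finally show ?thesis using False by simp
  qed
qed

lemma integral_lborel_prod_cart:
  fixes f :: "'n::finite \<Rightarrow> real \<Rightarrow> complex"
  assumes "\<And>i. integrable lborel (f i)"
  shows "(\<integral>x. (\<Prod>i\<in>UNIV. f i (x $ i)) \<partial>(lborel :: (real ^ 'n) measure)) = (\<Prod>i\<in>UNIV. \<integral>y. f i y \<partial>lborel)"
proof -
  define coord where "coord = (inv (\<lambda>i::'n. axis i (1::real)))"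
  have inj: "inj (\<lambda>i::'n. axis i (1::real))" by (auto simp: inj_def axis_eq_axis)
  have coord: "coord (axis i 1) = i" for i
    unfolding coord_def by (rule inv_f_f[OF inj])
  have Basis: "(Basis :: (real ^ 'n) set) = range (\<lambda>i. axis i 1)"
    by (auto simp: Basis_vec_def)
  have "(\<integral>x. (\<Prod>b\<in>Basis. f (coord b) (x \<bullet> b)) \<partial>(lborel :: (real ^ 'n) measure))
      = (\<Prod>b\<in>(Basis :: (real ^ 'n) set). \<integral>y. f (coord b) y \<partial>lborel)"
    by (rule integral_lborel_prod) (rule assms)
  then show ?thesis
    by (simp add: Basis prod.reindex[OF inj] coord inner_axis)
qed

text \<open>
  The exponent \<open>k \<bullet> x\<close> of the characters of the torus; the mixed type of the factors rules out the
  inner product itself.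
\<close>

definition phase :: "int ^ 2 \<Rightarrow> real ^ 2 \<Rightarrow> real" where
  "phase k x = (\<Sum>i\<in>UNIV. of_int (k $ i) * x $ i)"

lemma phase_add: "phase (k + l) x = phase k x + phase l x"
  and phase_diff: "phase (k - l) x = phase k x - phase l x"
  and phase_minus: "phase (- k) x = - phase k x"
  by (simp_all add: phase_def algebra_simps sum.distrib sum_subtractf sum_negf)

lemma continuous_on_phase [continuous_intros]: "continuous_on S (phase k)"
  unfolding phase_def by (intro continuous_intros)

lemma integrable_torus:
  fixes f :: "real ^ 2 \<Rightarrow> 'a::euclidean_space"
  assumes "continuous_on (cbox 0 (\<chi> i. 2 * pi)) f"
  shows "integrable torus f"
  unfolding torus_def using assms by (rule continuous_imp_integrable)

text \<open>
  The character is a product of one-dimensional characters and the cell is a product of intervals, so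
  the integral factors.
\<close>

lemma integral_cis_phase: "(\<integral>x. cis (phase k x) \<partial>torus) = (if k = 0 then 4 * pi\<^sup>2 else 0)"
proof -
  have "(\<integral>x. cis (phase k x) \<partial>torus)
      = (\<integral>x. indicator (cbox 0 (\<chi> i. 2 * pi)) x *\<^sub>R cis (phase k x) \<partial>lebesgue)"
    unfolding torus_def by (subst integral_restrict_space) auto
  also have "\<dots> = (\<integral>x. indicator (cbox 0 (\<chi> i. 2 * pi)) x *\<^sub>R cis (phase k x) \<partial>lborel)"
    by (rule integral_completion)
       (simp, intro borel_measurable_scaleR borel_measurable_indicator
          borel_measurable_continuous_onI continuous_intros, simp)
  also have "\<dots> = (\<integral>x. (\<Prod>i\<in>UNIV. indicator {0..2*pi} (x $ i) *\<^sub>R cis (of_int (k $ i) * x $ i)) \<partial>lborel)"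
  proof (rule Bochner_Integration.integral_cong)
    fix x :: "real ^ 2"
    have "x \<in> cbox 0 (\<chi> i. 2 * pi) \<longleftrightarrow> x $ 1 \<in> {0..2*pi} \<and> x $ 2 \<in> {0..2*pi}"
      by (auto simp: mem_box_cart forall_2)
    then show "indicator (cbox 0 (\<chi> i. 2 * pi)) x *\<^sub>R cis (phase k x)
        = (\<Prod>i\<in>UNIV. indicator {0..2*pi} (x $ i) *\<^sub>R cis (of_int (k $ i) * x $ i))"
      by (auto simp: indicator_def phase_def UNIV_2 cis_mult)
  qed simp
  also have "\<dots> = (\<Prod>i\<in>UNIV. if k $ i = 0 then 2 * pi else 0)"
    by (subst integral_lborel_prod_cart) (simp_all add: integrable_cis_period integral_cis_period)
  also have "\<dots> = (if k = 0 then 4 * pi\<^sup>2 else 0)"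
    by (auto simp: UNIV_2 vec_eq_iff forall_2 power2_eq_square)
  finally show ?thesis .
qed

lemma integral_cos_phase: "(\<integral>x. cos (phase k x) \<partial>torus) = (if k = 0 then 4 * pi\<^sup>2 else 0)"
  and integral_sin_phase: "(\<integral>x. sin (phase k x) \<partial>torus) = 0"
proof -
  have int: "integrable torus (\<lambda>x. cis (phase k x))"
    by (intro integrable_torus continuous_intros)
  have "(\<integral>x. Re (cis (phase k x)) \<partial>torus) = Re (\<integral>x. cis (phase k x) \<partial>torus)"
    by (rule integral_Re[OF int])
  then show "(\<integral>x. cos (phase k x) \<partial>torus) = (if k = 0 then 4 * pi\<^sup>2 else 0)"
    by (simp add: integral_cis_phase split: if_splits)
  have "(\<integral>x. Im (cis (phase k x)) \<partial>torus) = Im (\<integral>x. cis (phase k x) \<partial>torus)"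
    by (rule integral_Im[OF int])
  then show "(\<integral>x. sin (phase k x) \<partial>torus) = 0"
    by (simp add: integral_cis_phase split: if_splits)
qed

text \<open>
  The Hartley kernel, normalised. It is used instead of complex exponentials or separate sines and
  cosines because it is real and indexed by all of \<open>\<int>\<^sup>2\<close>, and because differentiation just sends the
  function with index \<open>k\<close> to a multiple of the one with index \<open>- k\<close>.
\<close>

definition hartley :: "int ^ 2 \<Rightarrow> real ^ 2 \<Rightarrow> real" where
  "hartley k x = (cos (phase k x) + sin (phase k x)) / (2 * pi)"

lemma continuous_on_hartley [continuous_intros]: "continuous_on S (hartley k)"
  unfolding hartley_def by (intro continuous_intros) auto

lemma square_integrable_torus_continuous:
  assumes "continuous_on (cbox 0 (\<chi> i. 2 * pi)) f"
  shows "square_integrable torus f"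
  unfolding square_integrable_def
  using assms by (auto intro!: integrable_torus borel_measurable_integrable continuous_intros)

text \<open>
  The analogue of the addition rule for characters: the mixed products of sine and cosine combine to
  \<open>sin (a + b)\<close>, the others to \<open>cos (a - b)\<close>. Orthonormality follows, since the mean of the sine
  vanishes for every index.
\<close>

lemma hartley_mult: "hartley k x * hartley l x = (cos (phase (k - l) x) + sin (phase (k + l) x)) / (4 * pi\<^sup>2)"
  by (simp add: hartley_def phase_add phase_diff cos_diff sin_add power2_eq_square algebra_simps add_divide_distrib)

lemma orthonormal_hartley: "orthonormal_on torus UNIV hartley"
proof -
  have "(\<integral>x. hartley k x * hartley l x \<partial>torus) = (if k = l then 1 else 0)" for k l
  proof -
    have "(\<integral>x. hartley k x * hartley l x \<partial>torus)
        = (\<integral>x. (cos (phase (k - l) x) + sin (phase (k + l) x)) / (4 * pi\<^sup>2) \<partial>torus)"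
      by (simp only: hartley_mult)
    also have "\<dots> = ((\<integral>x. cos (phase (k - l) x) \<partial>torus) + (\<integral>x. sin (phase (k + l) x) \<partial>torus)) / (4 * pi\<^sup>2)"
      by (simp, subst Bochner_Integration.integral_add) (auto intro!: integrable_torus continuous_intros)
    finally show ?thesis by (simp add: integral_cos_phase integral_sin_phase)
  qed
  then show ?thesis
    unfolding orthonormal_on_def
    by (auto intro!: square_integrable_torus_continuous continuous_intros)
qed

text \<open>
  Here \<open>(hartley k x)\<^sup>2\<close> is \<open>1 + sin (2 k \<bullet> x)\<close> up to the normalisation, and the sine, being odd in \<open>k\<close>,
  cancels in a symmetric set of frequencies.
\<close>

lemma sum_hartley_square:
  assumes "finite A" "\<And>k. k \<in> A \<Longrightarrow> - k \<in> A"
  shows "(\<Sum>k\<in>A. (hartley k x)\<^sup>2) = card A / (4 * pi\<^sup>2)"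
proof -
  have "(\<Sum>k\<in>A. sin (phase (k + k) x)) = (\<Sum>k\<in>A. sin (phase (- k + - k) x))"
    by (rule sum.reindex_bij_witness[of _ uminus uminus]) (use assms in auto)
  also have "\<dots> = - (\<Sum>k\<in>A. sin (phase (k + k) x))"
    by (simp add: phase_add phase_diff phase_minus sum_negf[symmetric] del: minus_add_distrib)
  finally have odd: "(\<Sum>k\<in>A. sin (phase (k + k) x)) = 0" by simp
  have "(\<Sum>k\<in>A. (hartley k x)\<^sup>2) = (\<Sum>k\<in>A. 1 + sin (phase (k + k) x)) / (4 * pi\<^sup>2)"
    unfolding power2_eq_square[of "hartley _ _"] hartley_mult by (simp add: sum_divide_distrib phase_def)
  then show ?thesis by (simp only: sum.distrib odd) simp
qed

section \<open>Completeness of the Hartley basis\<close>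

inductive trig_poly :: "(real ^ 2 \<Rightarrow> real) \<Rightarrow> bool" where
  zero: "trig_poly (\<lambda>x. 0)"
| step: "trig_poly p \<Longrightarrow> trig_poly (\<lambda>x. a * hartley k x + p x)"

lemma trig_poly_add: "trig_poly p \<Longrightarrow> trig_poly q \<Longrightarrow> trig_poly (\<lambda>x. p x + q x)"
  by (induction rule: trig_poly.induct) (auto simp: add.assoc intro: trig_poly.step)

lemma trig_poly_cmult: "trig_poly p \<Longrightarrow> trig_poly (\<lambda>x. c * p x)"
proof (induction rule: trig_poly.induct)
  case (step p a k)
  then have "trig_poly (\<lambda>x. (c * a) * hartley k x + c * p x)" by (intro trig_poly.step)
  then show ?case by (simp add: algebra_simps)
qed (simp add: trig_poly.zero)

lemma trig_poly_hartley: "trig_poly (hartley k)"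
  using trig_poly.step[OF trig_poly.zero, of 1 k] by simp

lemma trig_poly_cos: "trig_poly (\<lambda>x. cos (phase k x))"
proof -
  have "(\<lambda>x. cos (phase k x)) = (\<lambda>x. pi * hartley k x + pi * hartley (- k) x)"
    by (rule ext) (simp add: hartley_def phase_minus field_simps)
  then show ?thesis by (simp add: trig_poly_add trig_poly_cmult trig_poly_hartley)
qed

lemma trig_poly_sin: "trig_poly (\<lambda>x. sin (phase k x))"
proof -
  have "(\<lambda>x. sin (phase k x)) = (\<lambda>x. pi * hartley k x + - pi * hartley (- k) x)"
    by (rule ext) (simp add: hartley_def phase_minus field_simps)
  then show ?thesis by (simp only: trig_poly_add trig_poly_cmult trig_poly_hartley)
qed

lemma trig_poly_const: "trig_poly (\<lambda>x. c)"
  using trig_poly_cmult[OF trig_poly_cos[of 0], of c] by (simp add: phase_def)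

text \<open>
  By bilinearity this reduces to \<open>hartley_mult\<close>.
\<close>

lemma trig_poly_mult:
  assumes "trig_poly p" "trig_poly q"
  shows "trig_poly (\<lambda>x. p x * q x)"
  using assms(1)
proof (induction rule: trig_poly.induct)
  case (step p a k)
  have "trig_poly (\<lambda>x. hartley k x * q x)"
    using assms(2)
  proof (induction rule: trig_poly.induct)
    case (step q b l)
    have "trig_poly (\<lambda>x. (b / (4 * pi\<^sup>2)) * (cos (phase (k - l) x) + sin (phase (k + l) x)) + hartley k x * q x)"
      by (intro trig_poly_add trig_poly_cmult trig_poly_cos trig_poly_sin step)
    also have "(\<lambda>x. (b / (4 * pi\<^sup>2)) * (cos (phase (k - l) x) + sin (phase (k + l) x)) + hartley k x * q x)
        = (\<lambda>x. hartley k x * (b * hartley l x + q x))"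
    proof
      fix x
      show "(b / (4 * pi\<^sup>2)) * (cos (phase (k - l) x) + sin (phase (k + l) x)) + hartley k x * q x
          = hartley k x * (b * hartley l x + q x)"
        using hartley_mult[of k x l] by (simp add: distrib_left add_divide_distrib mult.left_commute[of _ b])
    qed
    finally show ?case .
  qed (simp add: trig_poly.zero)
  then have "trig_poly (\<lambda>x. a * (hartley k x * q x) + p x * q x)"
    by (intro trig_poly_add trig_poly_cmult step)
  then show ?case by (simp add: algebra_simps)
qed (simp add: trig_poly.zero)

lemma trig_poly_sum: "(\<And>i. i \<in> I \<Longrightarrow> trig_poly (f i)) \<Longrightarrow> trig_poly (\<lambda>x. \<Sum>i\<in>I. f i x)"
  by (induction I rule: infinite_finite_induct) (auto intro: trig_poly_add trig_poly.zero)

lemma trig_poly_representation: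
  assumes "trig_poly p"
  obtains A a where "finite A" "p = (\<lambda>x. \<Sum>k\<in>A. a k * hartley k x)"
proof -
  have "\<exists>A a. finite A \<and> p = (\<lambda>x. \<Sum>k\<in>A. a k * hartley k x)"
    using assms
  proof (induction rule: trig_poly.induct)
    case zero
    show ?case by (rule exI[of _ "{}"]) auto
  next
    case (step p a k)
    then obtain A b where A: "finite A" "p = (\<lambda>x. \<Sum>k\<in>A. b k * hartley k x)" by blast
    define b' where "b' l = (if l = k then a else 0) + (if l \<in> A then b l else 0)" for l
    have "(\<Sum>l\<in>insert k A. b' l * hartley l x) = a * hartley k x + p x" for x
    proof -
      have "(\<Sum>l\<in>insert k A. b' l * hartley l x)
          = (\<Sum>l\<in>insert k A. if l = k then a * hartley k x else 0)
            + (\<Sum>l\<in>insert k A. if l \<in> A then b l * hartley l x else 0)"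
        unfolding sum.distrib[symmetric] b'_def by (rule sum.cong) (auto simp: distrib_right)
      also have "(\<Sum>l\<in>insert k A. if l \<in> A then b l * hartley l x else 0) = p x"
        using A by (simp add: sum.inter_restrict[symmetric] insert_absorb Int_insert_left Int_absorb2)
      finally show ?thesis using A by simp
    qed
    then show ?case using A(1) by (intro exI[of _ "insert k A"] exI[of _ b']) auto
  qed
  then show thesis using that by blast
qed

text \<open>
  This realises the torus as a compact subset of a Euclidean space, on which polynomial functions are
  dense by the Stone-Weierstrass theorem.
\<close>

definition torus_embedding :: "real ^ 2 \<Rightarrow> complex ^ 2" where
  "torus_embedding x = (\<chi> i. cis (x $ i))"

lemma continuous_on_torus_embedding: "continuous_on S torus_embedding"
  unfolding torus_embedding_def by (intro continuous_intros)

text \<open>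
  A real-linear functional on \<open>\<complex>\<^sup>2\<close>, restricted to the torus, is a combination of the sines and cosines of
  the coordinates, and trigonometric polynomials form an algebra.
\<close>

lemma trig_poly_polynomial_embedding:
  assumes "real_polynomial_function g"
  shows "trig_poly (\<lambda>x. g (torus_embedding x))"
  using assms
proof (induction rule: real_polynomial_function.induct)
  case (linear f)
  interpret bounded_linear f by fact
  define c where "c i = f (axis i 1)" for i
  define s where "s i = f (axis i \<i>)" for i
  have ax: "cos (x $ i) = cos (phase (axis i 1) x)" "sin (x $ i) = sin (phase (axis i 1) x)" for x i
    by (simp_all add: phase_def axis_def if_distrib[of of_int] if_distrib[of "\<lambda>u. u * _"] cong: if_cong)
  have "f (torus_embedding x) = (\<Sum>i\<in>UNIV. c i * cos (x $ i) + s i * sin (x $ i))" for x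
  proof -
    have "torus_embedding x = (\<Sum>i\<in>UNIV. cos (x $ i) *\<^sub>R axis i 1 + sin (x $ i) *\<^sub>R axis i \<i>)"
      by (simp add: torus_embedding_def vec_eq_iff UNIV_2 forall_2 axis_def complex_eq_iff)
    then show ?thesis by (simp add: sum add scaleR c_def s_def mult.commute)
  qed
  then show ?case
    unfolding ax by (simp add: trig_poly_sum trig_poly_add trig_poly_cmult trig_poly_cos trig_poly_sin)
qed (auto intro: trig_poly_add trig_poly_mult trig_poly_const)

lemma torus_embedding_eq_interior:
  assumes x: "x \<in> box 0 (\<chi> i. 2 * pi)" and y: "y \<in> cbox 0 (\<chi> i. 2 * pi)"
    and eq: "torus_embedding x = torus_embedding y"
  shows "x = y"
proof -
  have "x $ i = y $ i" for i
  proof -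
    have xi: "0 < x $ i" "x $ i < 2 * pi" using x by (auto simp: mem_box_cart)
    have yi: "0 \<le> y $ i" "y $ i \<le> 2 * pi" using y by (auto simp: mem_box_cart)
    have "cis (x $ i) = cis (y $ i)"
      using arg_cong[OF eq, of "\<lambda>v. v $ i"] by (simp add: torus_embedding_def)
    then have "sin (x $ i) = sin (y $ i) \<and> cos (x $ i) = cos (y $ i)"
      by (simp add: complex_eq_iff)
    then obtain n :: int where n: "x $ i = y $ i + 2 * pi * of_int n"
      using sin_cos_eq_iff by blast
    have "2 * pi * of_int n < 2 * pi * 1" "2 * pi * (-1) < 2 * pi * of_int n" using xi yi n by linarith+
    then have "of_int n < (1::real)" "(-1::real) < of_int n" by (simp_all only: mult_less_cancel_left_pos pi_gt_zero zero_less_mult_iff zero_less_numeral simp_thms)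
    then have "n = 0" by linarith
    then show ?thesis using n by simp
  qed
  then show ?thesis by (simp add: vec_eq_iff)
qed

text \<open>
  A function vanishing on the boundary of the cell is compatible with the identification of opposite
  sides, so it descends to a function \<open>F\<close> on the embedded torus. Continuity of \<open>F\<close> holds because the
  preimage of a closed set under \<open>F\<close> is the image of a compact subset of the cell.
\<close>

lemma trig_poly_uniform_approx:
  assumes h: "continuous_on (cbox 0 (\<chi> i. 2 * pi)) h"
    and h0: "\<And>x. x \<in> cbox 0 (\<chi> i. 2 * pi) \<Longrightarrow> x \<notin> box 0 (\<chi> i. 2 * pi) \<Longrightarrow> h x = 0"
    and e: "0 < e"
  obtains p where "trig_poly p" "\<And>x. x \<in> cbox 0 (\<chi> i. 2 * pi) \<Longrightarrow> \<bar>h x - p x\<bar> < e"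
proof -
  define Q :: "(real ^ 2) set" where "Q = cbox 0 (\<chi> i. 2 * pi)"
  define T where "T = torus_embedding ` Q"
  have Q: "compact Q" by (simp add: Q_def)
  have T: "compact T"
    unfolding T_def by (rule compact_continuous_image[OF continuous_on_torus_embedding Q])
  have same: "h x = h y" if "x \<in> Q" "y \<in> Q" "torus_embedding x = torus_embedding y" for x y
    using that torus_embedding_eq_interior[of x y] torus_embedding_eq_interior[of y x] h0
    unfolding Q_def by metis
  define F where "F z = h (SOME x. x \<in> Q \<and> torus_embedding x = z)" for z
  have F: "F (torus_embedding x) = h x" if "x \<in> Q" for x
    unfolding F_def
  proof (rule someI2[of _ x])
    show "x \<in> Q \<and> torus_embedding x = torus_embedding x" using that by simp
    show "h y = h x" if "y \<in> Q \<and> torus_embedding y = torus_embedding x" for y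
      using same[of y x] that \<open>x \<in> Q\<close> by blast
  qed
  have "continuous_on T F"
  proof (subst continuous_on_closed_vimage[OF compact_imp_closed[OF T]], intro allI impI)
    fix C :: "real set" assume C: "closed C"
    have "F -` C \<inter> T = torus_embedding ` (Q \<inter> h -` C)"
      unfolding T_def using F by auto
    moreover have "compact (Q \<inter> h -` C)"
    proof -
      have "closed (Q \<inter> h -` C)"
        using continuous_closed_preimage[OF _ compact_imp_closed[OF Q] C] h by (simp add: Q_def)
      from compact_Int_closed[OF Q this] show ?thesis by (simp add: Int_assoc[symmetric])
    qed
    ultimately show "closed (F -` C \<inter> T)"
      by (simp add: compact_imp_closed compact_continuous_image[OF continuous_on_torus_embedding])
  qed
  then obtain g where g: "real_polynomial_function g" "\<And>z. z \<in> T \<Longrightarrow> \<bar>F z - g z\<bar> < e"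
    using Stone_Weierstrass_real_polynomial_function[OF T _ e] by blast
  show thesis
  proof (rule that[OF trig_poly_polynomial_embedding[OF g(1)]])
    fix x :: "real ^ 2" assume "x \<in> cbox 0 (\<chi> i. 2 * pi)"
    then have "x \<in> Q" by (simp add: Q_def)
    then show "\<bar>h x - g (torus_embedding x)\<bar> < e"
      using g(2)[of "torus_embedding x"] F by (simp add: T_def)
  qed
qed

lemma continuous_on_trig_poly: "trig_poly p \<Longrightarrow> continuous_on S p"
  by (induction rule: trig_poly.induct) (auto intro!: continuous_intros)

lemma integral_square_add_le:
  assumes "square_integrable M f" "square_integrable M g"
  shows "(\<integral>x. (f x + g x)\<^sup>2 \<partial>M) \<le> 2 * (\<integral>x. (f x)\<^sup>2 \<partial>M) + 2 * (\<integral>x. (g x)\<^sup>2 \<partial>M)"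
proof -
  have "(\<integral>x. (f x + g x)\<^sup>2 \<partial>M) \<le> (\<integral>x. 2 * (f x)\<^sup>2 + 2 * (g x)\<^sup>2 \<partial>M)"
  proof (rule integral_mono)
    show "integrable M (\<lambda>x. (f x + g x)\<^sup>2)"
      using square_integrable_add[OF assms] by (simp add: square_integrable_def)
    show "integrable M (\<lambda>x. 2 * (f x)\<^sup>2 + 2 * (g x)\<^sup>2)"
      using assms by (simp add: square_integrable_def)
    show "(f x + g x)\<^sup>2 \<le> 2 * (f x)\<^sup>2 + 2 * (g x)\<^sup>2" for x
      using sum_squares_bound[of "f x" "g x"] by (simp add: power2_sum)
  qed
  also have "\<dots> = 2 * (\<integral>x. (f x)\<^sup>2 \<partial>M) + 2 * (\<integral>x. (g x)\<^sup>2 \<partial>M)"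
    using assms by (simp add: square_integrable_def)
  finally show ?thesis .
qed

text \<open>
  Every approximation step in mean square below is an instance of this consequence of dominated
  convergence.
\<close>

lemma dominated_mean_square_approx:
  fixes f :: "'a \<Rightarrow> real"
  assumes f: "f \<in> borel_measurable M" and s: "\<And>n. s n \<in> borel_measurable M"
    and w: "integrable M w" and bound: "\<And>n. AE x in M. (f x - s n x)\<^sup>2 \<le> w x"
    and lim: "AE x in M. (\<lambda>n. s n x) \<longlonglongrightarrow> f x" and e: "0 < e"
  obtains n where "(\<integral>x. (f x - s n x)\<^sup>2 \<partial>M) < e"
proof -
  have "(\<lambda>n. \<integral>x. (f x - s n x)\<^sup>2 \<partial>M) \<longlonglongrightarrow> (\<integral>x. 0 \<partial>M)"
  proof (rule integral_dominated_convergence[OF _ _ w])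
    show "AE x in M. (\<lambda>n. (f x - s n x)\<^sup>2) \<longlonglongrightarrow> 0"
      using lim
    proof eventually_elim
      case (elim x)
      then have "(\<lambda>n. (f x - s n x)\<^sup>2) \<longlonglongrightarrow> (f x - f x)\<^sup>2" by (intro tendsto_intros)
      then show ?case by simp
    qed
  qed (use f s bound in auto)
  then have "\<forall>\<^sub>F n in sequentially. (\<integral>x. (f x - s n x)\<^sup>2 \<partial>M) < e"
    using e by (intro order_tendstoD) auto
  then show thesis using that by (auto simp: eventually_sequentially)
qed

definition clamp_abs :: "real \<Rightarrow> real \<Rightarrow> real" where
  "clamp_abs B y = max (- B) (min B y)"

lemma bounded_mean_square_approx:
  assumes f: "square_integrable M f" and e: "0 < e"
  obtains n :: nat where "(\<integral>x. (f x - clamp_abs n (f x))\<^sup>2 \<partial>M) < e"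
proof (rule dominated_mean_square_approx[of f M "\<lambda>n x. clamp_abs (real n) (f x)" "\<lambda>x. (f x)\<^sup>2"])
  show "AE x in M. (f x - clamp_abs (real n) (f x))\<^sup>2 \<le> (f x)\<^sup>2" for n
  proof (rule AE_I2)
    fix x
    have "\<bar>f x - clamp_abs (real n) (f x)\<bar> \<le> \<bar>f x\<bar>" by (auto simp: clamp_abs_def)
    then show "(f x - clamp_abs (real n) (f x))\<^sup>2 \<le> (f x)\<^sup>2" by (simp add: abs_le_square_iff)
  qed
  show "AE x in M. (\<lambda>n. clamp_abs (real n) (f x)) \<longlonglongrightarrow> f x"
  proof (rule AE_I2)
    fix x
    have "\<forall>\<^sub>F n in sequentially. \<bar>f x\<bar> \<le> real n"
      using eventually_ge_at_top[of "nat \<lceil>\<bar>f x\<bar>\<rceil>"] by eventually_elim linarith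
    then have "\<forall>\<^sub>F n in sequentially. f x = clamp_abs (real n) (f x)"
      by eventually_elim (auto simp: clamp_abs_def)
    then show "(\<lambda>n. clamp_abs (real n) (f x)) \<longlonglongrightarrow> f x"
      by (rule Lim_transform_eventually[OF tendsto_const])
  qed
qed (use f e that in \<open>auto simp: square_integrable_def clamp_abs_def\<close>)

lemma AE_torus_not_in:
  assumes "negligible N" shows "AE x in torus. x \<notin> N"
proof -
  have "AE x in lebesgue. x \<notin> N"
    using assms by (intro AE_not_in) (simp add: negligible_iff_null_sets)
  then show ?thesis
    unfolding torus_def by (subst AE_restrict_space_iff) auto
qed

lemma finite_measure_torus: "finite_measure torus"
  unfolding torus_def by (rule finite_measure_lebesgue_on) simp

lemma space_torus: "space torus = cbox 0 (\<chi> i. 2 * pi)"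
  by (simp add: torus_def)

text \<open>
  A measurable function is an almost everywhere limit of continuous functions. Clamping these to
  \<open>[-B, B]\<close> makes them uniformly bounded, and multiplying them by cutoffs that vanish on the boundary
  of the cell and increase to \<open>1\<close> inside changes the limit only on a null set.
\<close>

lemma continuous_mean_square_approx:
  fixes f :: "real ^ 2 \<Rightarrow> real"
  assumes f: "f \<in> borel_measurable torus" and B: "\<And>x. \<bar>f x\<bar> \<le> B" and e: "0 < e"
  obtains h where "continuous_on (cbox 0 (\<chi> i. 2 * pi)) h"
    "\<And>x. x \<in> cbox 0 (\<chi> i. 2 * pi) \<Longrightarrow> x \<notin> box 0 (\<chi> i. 2 * pi) \<Longrightarrow> h x = 0"
    "(\<integral>x. (f x - h x)\<^sup>2 \<partial>torus) < e"
proof -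
  define Q :: "(real ^ 2) set" where "Q = cbox 0 (\<chi> i. 2 * pi)"
  have B0: "0 \<le> B" by (rule order_trans[OF abs_ge_zero B])
  have "f measurable_on Q"
    using f by (subst measurable_on_iff_borel_measurable) (auto simp: torus_def Q_def)
  then obtain N g where N: "negligible N" and g: "\<And>n. continuous_on UNIV (g n)"
    and lim: "\<And>x. x \<notin> N \<Longrightarrow> (\<lambda>n. g n x) \<longlonglongrightarrow> (if x \<in> Q then f x else 0)"
    unfolding measurable_on_def by blast
  \<comment> \<open>On the cell, \<open>w\<close> is nonnegative and vanishes exactly on the boundary.\<close>
  define w :: "real ^ 2 \<Rightarrow> real" where "w x = sin (x $ 1 / 2) * sin (x $ 2 / 2)" for x
  define h where "h n x = min 1 (real n * w x) * clamp_abs B (g n x)" for n :: nat and x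
  have w0: "0 \<le> w x" if "x \<in> Q" for x
  proof -
    have "0 \<le> sin (x $ i / 2)" for i
      using that by (intro sin_ge_zero) (auto simp: Q_def mem_box_cart mult.commute)
    then show ?thesis by (simp add: w_def)
  qed
  have cont: "continuous_on S (h n)" for n S
    unfolding h_def w_def clamp_abs_def
    by (intro continuous_intros continuous_on_subset[OF g]) auto
  have boundary: "h n x = 0" if "x \<in> Q" "x \<notin> box 0 (\<chi> i. 2 * pi)" for n x
  proof -
    have "x $ 1 = 0 \<or> x $ 1 = 2 * pi \<or> x $ 2 = 0 \<or> x $ 2 = 2 * pi"
      using that by (force simp: Q_def mem_box_cart forall_2)
    then have "w x = 0" by (auto simp: w_def)
    then show ?thesis by (simp add: h_def)
  qed
  have hm: "h n \<in> borel_measurable torus" for n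
    by (intro borel_measurable_integrable integrable_torus cont)
  have hB: "\<bar>h n x\<bar> \<le> B" if "x \<in> Q" for n x
  proof -
    have "\<bar>h n x\<bar> \<le> 1 * B"
      unfolding h_def abs_mult using w0[OF that] B0
      by (intro mult_mono) (auto simp: clamp_abs_def)
    then show ?thesis by simp
  qed
  obtain n where "(\<integral>x. (f x - h n x)\<^sup>2 \<partial>torus) < e"
  proof (rule dominated_mean_square_approx[OF f hm _ _ _ e, of "\<lambda>_. (2 * B)\<^sup>2"])
    interpret finite_measure torus by (rule finite_measure_torus)
    show "integrable torus (\<lambda>_. (2 * B)\<^sup>2)" by simp
    show "AE x in torus. (f x - h n x)\<^sup>2 \<le> (2 * B)\<^sup>2" for n
    proof (rule AE_I2)
      fix x assume "x \<in> space torus"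
      then have "\<bar>f x - h n x\<bar> \<le> \<bar>2 * B\<bar>"
        using B[of x] hB[of x n] B0 by (simp add: space_torus Q_def)
      then show "(f x - h n x)\<^sup>2 \<le> (2 * B)\<^sup>2" by (simp only: abs_le_square_iff)
    qed
    have "negligible (Q - box 0 (\<chi> i. 2 * pi))"
      unfolding Q_def by (rule negligible_frontier_interval)
    from AE_torus_not_in[OF N] AE_torus_not_in[OF this] AE_space[of torus]
    show "AE x in torus. (\<lambda>n. h n x) \<longlonglongrightarrow> f x"
    proof eventually_elim
      case (elim x)
      then have x: "x \<in> Q" "x \<in> box 0 (\<chi> i. 2 * pi)" by (auto simp: space_torus Q_def)
      have "0 < sin (x $ i / 2)" for i
        using x(2) by (intro sin_gt_zero) (auto simp: mem_box_cart mult.commute)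
      then have w: "0 < w x" by (simp add: w_def)
      have "\<forall>\<^sub>F n in sequentially. 1 \<le> real n * w x"
        using eventually_ge_at_top[of "nat \<lceil>1 / w x\<rceil>"]
      proof eventually_elim
        case (elim n)
        then have "1 / w x \<le> real n" by linarith
        then show ?case using w by (simp add: field_simps)
      qed
      then have ev: "\<forall>\<^sub>F n in sequentially. clamp_abs B (g n x) = h n x"
        by eventually_elim (simp add: h_def)
      have "(\<lambda>n. clamp_abs B (g n x)) \<longlonglongrightarrow> clamp_abs B (f x)"
        unfolding clamp_abs_def using lim[OF elim(1)] x by (intro tendsto_intros) simp
      moreover have "clamp_abs B (f x) = f x" using B[of x] by (simp add: clamp_abs_def)
      ultimately show ?case using Lim_transform_eventually[OF _ ev] by simp
    qed
  qed
  then show thesis using boundary by (intro that[OF cont]) (auto simp: Q_def)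
qed

text \<open>
  Truncation to a bounded function, then approximation by a continuous one, then by a trigonometric
  polynomial. The constants \<open>e / 4\<close> and \<open>e / 16\<close> pay for the factors \<open>2\<close> in
  \<open>integral_square_add_le\<close>, which is used twice.
\<close>

lemma trig_poly_dense:
  assumes f: "square_integrable torus f" and e: "0 < e"
  obtains p where "trig_poly p" "(\<integral>x. (f x - p x)\<^sup>2 \<partial>torus) < e"
proof -
  obtain n :: nat where n: "(\<integral>x. (f x - clamp_abs n (f x))\<^sup>2 \<partial>torus) < e / 4"
    using bounded_mean_square_approx[OF f, of "e / 4"] e by auto
  define g where "g x = clamp_abs (real n) (f x)" for x
  have gm: "g \<in> borel_measurable torus"
    using f unfolding g_def clamp_abs_def square_integrable_def by (intro borel_measurable_max borel_measurable_min) auto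
  have gB: "\<bar>g x\<bar> \<le> real n" for x by (auto simp: g_def clamp_abs_def)
  have g: "square_integrable torus g"
    unfolding square_integrable_def
  proof (intro conjI gm finite_measure.integrable_const_bound[OF finite_measure_torus, of _ "(real n)\<^sup>2"] AE_I2)
    show "norm ((g x)\<^sup>2) \<le> (real n)\<^sup>2" for x
      using power_mono[OF gB[of x], of 2] by simp
  qed (use gm in simp)
  obtain h where h: "continuous_on (cbox 0 (\<chi> i. 2 * pi)) h"
    "\<And>x. x \<in> cbox 0 (\<chi> i. 2 * pi) \<Longrightarrow> x \<notin> box 0 (\<chi> i. 2 * pi) \<Longrightarrow> h x = 0"
    "(\<integral>x. (g x - h x)\<^sup>2 \<partial>torus) < e / 16"
    using continuous_mean_square_approx[OF gm gB, of "e / 16"] e by auto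
  define m where "m = measure torus (space torus)"
  have m0: "0 \<le> m" by (simp add: m_def)
  define d where "d = sqrt (e / (16 * (m + 1)))"
  have d: "0 < d" using e m0 by (simp add: d_def)
  obtain p where p: "trig_poly p" "\<And>x. x \<in> cbox 0 (\<chi> i. 2 * pi) \<Longrightarrow> \<bar>h x - p x\<bar> < d"
    using trig_poly_uniform_approx[OF h(1,2) d] by blast
  have h2: "square_integrable torus h" and p2: "square_integrable torus p"
    by (intro square_integrable_torus_continuous h continuous_on_trig_poly p)+
  have "(\<integral>x. (h x - p x)\<^sup>2 \<partial>torus) \<le> (\<integral>x. d\<^sup>2 \<partial>torus)"
  proof (rule integral_mono)
    show "integrable torus (\<lambda>x. (h x - p x)\<^sup>2)"
      using square_integrable_diff[OF h2 p2] by (simp add: square_integrable_def)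
    show "integrable torus (\<lambda>x. d\<^sup>2)"
      using finite_measure.integrable_const[OF finite_measure_torus] .
    fix x assume "x \<in> space torus"
    then have "\<bar>h x - p x\<bar> \<le> \<bar>d\<bar>" using p(2)[of x] d by (simp add: space_torus)
    then show "(h x - p x)\<^sup>2 \<le> d\<^sup>2" by (simp only: abs_le_square_iff)
  qed
  also have "\<dots> = m * (e / (16 * (m + 1)))" using e m0 by (simp add: m_def d_def)
  also have "\<dots> \<le> e / 16" using e m0 by (simp add: field_simps)
  finally have hp: "(\<integral>x. (h x - p x)\<^sup>2 \<partial>torus) \<le> e / 16" .
  have "(\<integral>x. (g x - p x)\<^sup>2 \<partial>torus) = (\<integral>x. ((g x - h x) + (h x - p x))\<^sup>2 \<partial>torus)" by simp
  also have "\<dots> \<le> 2 * (\<integral>x. (g x - h x)\<^sup>2 \<partial>torus) + 2 * (\<integral>x. (h x - p x)\<^sup>2 \<partial>torus)"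
    by (intro integral_square_add_le square_integrable_diff g h2 p2)
  finally have gp: "(\<integral>x. (g x - p x)\<^sup>2 \<partial>torus) < e / 4" using h(3) hp by simp
  have "(\<integral>x. (f x - p x)\<^sup>2 \<partial>torus) = (\<integral>x. ((f x - g x) + (g x - p x))\<^sup>2 \<partial>torus)" by simp
  also have "\<dots> \<le> 2 * (\<integral>x. (f x - g x)\<^sup>2 \<partial>torus) + 2 * (\<integral>x. (g x - p x)\<^sup>2 \<partial>torus)"
    by (intro integral_square_add_le square_integrable_diff f g p2)
  finally have "(\<integral>x. (f x - p x)\<^sup>2 \<partial>torus) < e" using n gp by (simp add: g_def)
  then show thesis by (rule that[OF p(1)])
qed

text \<open>
  Parseval's identity in the form of an approximation statement. The orthogonal projection to the
  frequencies of an approximating trigonometric polynomial is at least as close to \<open>f\<close> as that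
  polynomial.
\<close>

lemma hartley_complete:
  assumes f: "square_integrable torus f" and e: "0 < e"
  obtains A where "finite A"
    "(\<integral>x. (f x)\<^sup>2 \<partial>torus) < (\<Sum>k\<in>A. (\<integral>x. f x * hartley k x \<partial>torus)\<^sup>2) + e"
proof -
  obtain p where p: "trig_poly p" "(\<integral>x. (f x - p x)\<^sup>2 \<partial>torus) < e"
    using trig_poly_dense[OF f e] .
  obtain A a where A: "finite A" "p = (\<lambda>x. \<Sum>k\<in>A. a k * hartley k x)"
    using trig_poly_representation[OF p(1)] .
  have "(\<integral>x. (f x)\<^sup>2 \<partial>torus) - (\<Sum>k\<in>A. (\<integral>x. f x * hartley k x \<partial>torus)\<^sup>2) \<le> (\<integral>x. (f x - p x)\<^sup>2 \<partial>torus)"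
    unfolding A(2) integral_square_diff_orthonormal[OF A(1) orthonormal_on_subset[OF orthonormal_hartley subset_UNIV] f]
    by (simp add: sum_nonneg)
  then show thesis using p(2) by (intro that[OF A(1)]) linarith
qed

section \<open>Fourier coefficients of weak gradients\<close>

lemma phase_axis: "phase k (axis i t) = of_int (k $ i) * t"
  by (simp add: phase_def axis_def if_distrib[of "\<lambda>u. _ * u"] cong: if_cong)

lemma phase_add_right: "phase k (x + y) = phase k x + phase k y"
  by (simp add: phase_def distrib_left sum.distrib)

lemma bounded_linear_phase: "bounded_linear (phase k)"
  unfolding phase_def by (intro bounded_linear_sum bounded_linear_mult_right[THEN bounded_linear_compose] bounded_linear_vec_nth)

lemma has_derivative_hartley:
  "(hartley k has_derivative (\<lambda>v. phase k v * hartley (- k) x)) (at x)"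
proof -
  have p: "(phase k has_derivative phase k) (at x)"
    by (rule bounded_linear_imp_has_derivative[OF bounded_linear_phase])
  have "((\<lambda>x. cos (phase k x) + sin (phase k x)) has_derivative
      (\<lambda>v. - sin (phase k x) * phase k v + cos (phase k x) * phase k v)) (at x)"
    using p by (auto intro!: derivative_eq_intros simp: mult.commute)
  from has_derivative_mult_right[OF this, of "1 / (2 * pi)"]
  have d: "((\<lambda>x. 1 / (2 * pi) * (cos (phase k x) + sin (phase k x))) has_derivative
      (\<lambda>v. 1 / (2 * pi) * (- sin (phase k x) * phase k v + cos (phase k x) * phase k v))) (at x)" .
  have "(\<lambda>x. 1 / (2 * pi) * (cos (phase k x) + sin (phase k x))) = hartley k"
    by (rule ext) (simp add: hartley_def)
  moreover have "(\<lambda>v. 1 / (2 * pi) * (- sin (phase k x) * phase k v + cos (phase k x) * phase k v))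
      = (\<lambda>v. phase k v * hartley (- k) x)"
  proof
    have "1 / d * (- s * p + c * p) = p * ((c + - s) / d)" for d s p c :: real
      by (simp add: algebra_simps diff_divide_distrib)
    then show "1 / (2 * pi) * (- sin (phase k x) * phase k v + cos (phase k x) * phase k v)
      = phase k v * hartley (- k) x" for v
      unfolding hartley_def phase_minus cos_minus sin_minus by blast
  qed
  ultimately show ?thesis using d by metis
qed

lemma has_derivative_cmult_hartley:
  "((\<lambda>x. c * hartley k x) has_derivative (\<lambda>v. c * (phase k v * hartley (- k) x))) (at x)"
  by (rule has_derivative_mult_right[OF has_derivative_hartley])

lemma partial_deriv_cmult_hartley:
  "partial_deriv i (\<lambda>x. c * hartley k x) = (\<lambda>x. (c * of_int (k $ i)) * hartley (- k) x)"
  by (rule ext) (simp add: partial_deriv_def frechet_derivative_at[OF has_derivative_cmult_hartley, symmetric] phase_axis)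

text \<open>
  The constant factor and the index are generalised because differentiation changes both.
\<close>

lemma Ck_cmult_hartley: "Ck n (\<lambda>x. c * hartley k x)"
proof (induction n arbitrary: c k)
  case 0
  show ?case by (auto intro!: continuous_intros)
next
  case (Suc n)
  then show ?case
    using differentiableI[OF has_derivative_cmult_hartley] by (simp add: partial_deriv_cmult_hartley)
qed

lemma hartley_smooth_torus: "hartley k \<in> smooth_torus"
proof -
  have "hartley k (x + axis i (2 * pi)) = hartley k x" for x i
  proof -
    have "phase k (x + axis i (2 * pi)) = phase k x + 2 * pi * of_int (k $ i)"
      by (simp add: phase_add_right phase_axis)
    then show ?thesis by (simp add: hartley_def cos_add sin_add)
  qed
  then show ?thesis
    using Ck_cmult_hartley[of _ 1 k] by (simp add: smooth_torus_def periodic_def)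
qed

text \<open>
  The Hartley functions are admissible test functions, and the derivative of the one with index \<open>- k\<close>
  is a multiple of the one with index \<open>k\<close>.
\<close>

lemma weak_gradient_coefficient:
  assumes "has_weak_gradient f g"
  shows "(\<integral>x. g x $ i * hartley (- k) x \<partial>torus) = of_int (k $ i) * (\<integral>x. f x * hartley k x \<partial>torus)"
proof -
  have "(\<integral>x. f x * partial_deriv i (hartley (- k)) x \<partial>torus) = - (\<integral>x. g x $ i * hartley (- k) x \<partial>torus)"
    using assms hartley_smooth_torus unfolding has_weak_gradient_def by blast
  moreover have "partial_deriv i (hartley (- k)) = (\<lambda>x. - of_int (k $ i) * hartley k x)"
    using partial_deriv_cmult_hartley[of i 1 "- k"] by simp
  moreover have "(\<integral>x. f x * (- of_int (k $ i) * hartley k x) \<partial>torus)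
      = (\<integral>x. - of_int (k $ i) * (f x * hartley k x) \<partial>torus)"
    by (simp only: mult.left_commute)
  ultimately show ?thesis by simp
qed

lemma square_integrable_component:
  fixes g :: "real ^ 2 \<Rightarrow> real ^ 2"
  assumes "g \<in> L2_torus"
  shows "square_integrable torus (\<lambda>x. g x $ i)"
proof -
  have g: "g \<in> borel_measurable torus" "integrable torus (\<lambda>x. (norm (g x))\<^sup>2)"
    using assms by (auto simp: L2_torus_def)
  have m: "(\<lambda>x. g x $ i) \<in> borel_measurable torus"
    using g(1) by (rule measurable_compose) (intro borel_measurable_continuous_onI continuous_intros)
  have "integrable torus (\<lambda>x. (g x $ i)\<^sup>2)"
  proof (rule Bochner_Integration.integrable_bound[OF g(2)])
    show "AE x in torus. norm ((g x $ i)\<^sup>2) \<le> norm ((norm (g x))\<^sup>2)"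
      using component_le_norm_cart by (intro AE_I2) (simp add: abs_le_square_iff[symmetric])
  qed (use m in simp)
  then show ?thesis using m by (simp add: square_integrable_def)
qed

lemma L2_norm_square: "(L2_norm f)\<^sup>2 = (\<integral>x. f x \<bullet> f x \<partial>torus)"
  unfolding L2_norm_def L2_inner_def by (rule real_sqrt_pow2) simp

text \<open>
  Up to reflection of the index, \<open>k $ i\<close> times the coefficient of \<open>f\<close> is a coefficient of the
  \<open>i\<close>-th component of \<open>g\<close>, so this is Bessel's inequality for both components.
\<close>

lemma weighted_Bessel_weak_gradient:
  assumes g: "g \<in> L2_torus" "has_weak_gradient f g" and A: "finite A"
  shows "(\<Sum>k\<in>A. of_int ((k $ 1)\<^sup>2 + (k $ 2)\<^sup>2) * (\<integral>x. f x * hartley k x \<partial>torus)\<^sup>2) \<le> (L2_norm g)\<^sup>2"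
proof -
  define c where "c k = (\<integral>x. f x * hartley k x \<partial>torus)" for k
  have comp: "(\<Sum>k\<in>A. (of_int (k $ i) * c k)\<^sup>2) \<le> (\<integral>x. (g x $ i)\<^sup>2 \<partial>torus)" for i
  proof -
    have "(\<Sum>k\<in>A. (of_int (k $ i) * c k)\<^sup>2) = (\<Sum>k\<in>uminus ` A. (\<integral>x. g x $ i * hartley k x \<partial>torus)\<^sup>2)"
      by (subst sum.reindex) (auto simp: inj_on_def weak_gradient_coefficient[OF g(2)] c_def)
    also have "\<dots> \<le> (\<integral>x. (g x $ i)\<^sup>2 \<partial>torus)"
      using A by (intro Bessel_inequality square_integrable_component g
            orthonormal_on_subset[OF orthonormal_hartley subset_UNIV]) auto
    finally show ?thesis .
  qed
  have "(\<Sum>k\<in>A. of_int ((k $ 1)\<^sup>2 + (k $ 2)\<^sup>2) * (c k)\<^sup>2)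
      = (\<Sum>k\<in>A. (of_int (k $ 1) * c k)\<^sup>2) + (\<Sum>k\<in>A. (of_int (k $ 2) * c k)\<^sup>2)"
    by (simp add: sum.distrib[symmetric] power_mult_distrib distrib_right)
  also have "\<dots> \<le> (\<integral>x. (g x $ 1)\<^sup>2 \<partial>torus) + (\<integral>x. (g x $ 2)\<^sup>2 \<partial>torus)"
    by (intro add_mono comp)
  also have "\<dots> = (\<integral>x. (g x $ 1)\<^sup>2 + (g x $ 2)\<^sup>2 \<partial>torus)"
    using square_integrable_component[OF g(1)] by (simp add: square_integrable_def)
  also have "\<dots> = (L2_norm g)\<^sup>2"
    unfolding L2_norm_square by (simp add: inner_vec_def UNIV_2 power2_eq_square)
  finally show ?thesis by (simp add: c_def)
qed

section \<open>Lattice points in a disc\<close>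

text \<open>
  The lattice point estimate needs \<open>\<pi> / 4\<close> to stay away from \<open>1\<close>, and the crudest reading of Machin's
  formula already gives enough.
\<close>

lemma pi_le_16_5: "pi \<le> 16 / 5"
proof -
  have "arctan (1/5) \<le> 1/5" using arctan_le_self[of "1/5"] by simp
  moreover have "0 \<le> arctan (1/239)" by simp
  ultimately show ?thesis using machin by linarith
qed

lemma primitive_increment_bounds:
  fixes F f :: "real \<Rightarrow> real"
  assumes "a \<le> b" "continuous_on {a..b} F"
    and F': "\<And>x. a < x \<Longrightarrow> x < b \<Longrightarrow> (F has_real_derivative f x) (at x)"
    and bounds: "\<And>x. a < x \<Longrightarrow> x < b \<Longrightarrow> l \<le> f x \<and> f x \<le> u"
  shows "l * (b - a) \<le> F b - F a" and "F b - F a \<le> u * (b - a)"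
proof -
  have "l * (b - a) \<le> F b - F a \<and> F b - F a \<le> u * (b - a)"
  proof (cases "a < b")
    case True
    obtain x where x: "a < x" "x < b" "F b - F a = f x * (b - a)"
      using mvt[OF True assms(2), of "\<lambda>x. (*) (f x)"] F' by (auto simp: has_field_derivative_def)
    show ?thesis using bounds[OF x(1,2)] True x(3) by (auto intro: mult_right_mono)
  qed (use \<open>a \<le> b\<close> in auto)
  then show "l * (b - a) \<le> F b - F a" "F b - F a \<le> u * (b - a)" by auto
qed

text \<open>
  The sum is a lower Riemann sum for the area of a quarter disc of radius \<open>r\<close>; the area comes from the
  explicit primitive \<open>F\<close> of the half-chord length.
\<close>

lemma sum_sqrt_le_quarter_disc:
  assumes "real s \<le> r" "0 < r"
  shows "(\<Sum>a=1..s. sqrt (r\<^sup>2 - (real a)\<^sup>2)) \<le> pi * r\<^sup>2 / 4"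
proof -
  define F where "F x = (x * sqrt (r\<^sup>2 - x\<^sup>2) + r\<^sup>2 * arcsin (x / r)) / 2" for x
  have F': "(F has_real_derivative sqrt (r\<^sup>2 - x\<^sup>2)) (at x)" if x: "0 < x" "x < r" for x
  proof -
    have p: "0 < r\<^sup>2 - x\<^sup>2" using x by (simp add: power_strict_mono)
    have xr: "- 1 < x / r" "x / r < 1"
      using x divide_pos_pos[of x r] by (linarith, simp)
    have "1 - (x / r)\<^sup>2 = (r\<^sup>2 - x\<^sup>2) / r\<^sup>2"
      using assms by (simp add: field_simps)
    then have q: "sqrt (1 - (x / r)\<^sup>2) = sqrt (r\<^sup>2 - x\<^sup>2) / r"
      using assms by (simp add: real_sqrt_divide)
    have "(F has_real_derivative
        (sqrt (r\<^sup>2 - x\<^sup>2) + x * (inverse (sqrt (r\<^sup>2 - x\<^sup>2)) / 2 * (0 - 2 * x)) +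
          r\<^sup>2 * (inverse (sqrt (1 - (x / r)\<^sup>2)) * (1 / r))) / 2) (at x)"
      unfolding F_def
      by (rule derivative_eq_intros refl | use x p xr assms in \<open>simp; fail\<close>)+
    also have "r\<^sup>2 * (inverse (sqrt (1 - (x / r)\<^sup>2)) * (1 / r)) = r\<^sup>2 / sqrt (r\<^sup>2 - x\<^sup>2)"
      unfolding q using assms by (simp add: field_simps)
    also have "(sqrt (r\<^sup>2 - x\<^sup>2) + x * (inverse (sqrt (r\<^sup>2 - x\<^sup>2)) / 2 * (0 - 2 * x))
          + r\<^sup>2 / sqrt (r\<^sup>2 - x\<^sup>2)) / 2 = sqrt (r\<^sup>2 - x\<^sup>2)"
    proof -
      define w where "w = sqrt (r\<^sup>2 - x\<^sup>2)"
      have "0 < w" "r\<^sup>2 = w\<^sup>2 + x\<^sup>2" using p by (simp_all add: w_def)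
      then have "(w + x * (inverse w / 2 * (0 - 2 * x)) + r\<^sup>2 / w) / 2 = w"
        by (simp add: field_simps power2_eq_square)
      then show ?thesis by (simp only: w_def)
    qed
    finally show ?thesis .
  qed
  have cont: "continuous_on {0..r} F"
    unfolding F_def using assms
    by (auto intro!: continuous_intros simp: field_simps)
  have "sqrt (r\<^sup>2 - (real (Suc a))\<^sup>2) \<le> F (real (Suc a)) - F (real a)" if "a < s" for a
  proof -
    have ar: "real (Suc a) \<le> r" using that assms by linarith
    have "sqrt (r\<^sup>2 - (real (Suc a))\<^sup>2) * (real (Suc a) - real a) \<le> F (real (Suc a)) - F (real a)"
    proof (rule primitive_increment_bounds(1)[where f = "\<lambda>x. sqrt (r\<^sup>2 - x\<^sup>2)" and u = r])
      show "continuous_on {real a..real (Suc a)} F"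
        by (rule continuous_on_subset[OF cont]) (use ar in auto)
    next
      fix x assume x: "real a < x" "x < real (Suc a)"
      then show "(F has_real_derivative sqrt (r\<^sup>2 - x\<^sup>2)) (at x)"
        using ar by (intro F') auto
      have "sqrt (r\<^sup>2 - x\<^sup>2) \<le> r" using assms by (intro real_le_lsqrt) auto
      moreover have "x\<^sup>2 \<le> (real (Suc a))\<^sup>2" using x by (intro power_mono) auto
      ultimately show "sqrt (r\<^sup>2 - (real (Suc a))\<^sup>2) \<le> sqrt (r\<^sup>2 - x\<^sup>2) \<and> sqrt (r\<^sup>2 - x\<^sup>2) \<le> r"
        by simp
    qed simp
    then show ?thesis by simp
  qed
  then have "(\<Sum>a<s. sqrt (r\<^sup>2 - (real (Suc a))\<^sup>2)) \<le> (\<Sum>a<s. F (real (Suc a)) - F (real a))"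
    by (intro sum_mono) auto
  also have "\<dots> = F (real s) - F 0"
    using sum_lessThan_telescope[of "\<lambda>n. F (real n)" s] by simp
  also have "\<dots> \<le> F r - F 0"
  proof -
    have "0 * (r - real s) \<le> F r - F (real s)"
    proof (rule primitive_increment_bounds(1)[where f = "\<lambda>x. sqrt (r\<^sup>2 - x\<^sup>2)" and u = r])
      show "continuous_on {real s..r} F"
        by (rule continuous_on_subset[OF cont]) auto
    next
      fix x assume x: "real s < x" "x < r"
      then show "(F has_real_derivative sqrt (r\<^sup>2 - x\<^sup>2)) (at x)"
        by (intro F') auto
      have "sqrt (r\<^sup>2 - x\<^sup>2) \<le> r" using assms by (intro real_le_lsqrt) auto
      moreover have "x\<^sup>2 \<le> r\<^sup>2" using x by (intro power_mono) auto
      ultimately show "0 \<le> sqrt (r\<^sup>2 - x\<^sup>2) \<and> sqrt (r\<^sup>2 - x\<^sup>2) \<le> r"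
        by simp
    qed fact
    then show ?thesis by simp
  qed
  also have "\<dots> = pi * r\<^sup>2 / 4"
    using assms by (simp add: F_def)
  finally show ?thesis
    by (simp add: sum.atLeast1_atMost_eq)
qed

text \<open>
  The lattice points in one half-open quadrant, which contains one of its two bounding axes: its four
  rotations by right angles cover each nonzero lattice point exactly once.
\<close>

definition quarter_disc :: "nat \<Rightarrow> (nat \<times> nat) set" where
  "quarter_disc n = {(a, b). 1 \<le> a \<and> a\<^sup>2 + b\<^sup>2 \<le> n}"

lemma quarter_disc_subset:
  assumes "m\<^sup>2 > n" shows "quarter_disc n \<subseteq> {1..<m} \<times> {0..<m}"
proof
  fix p assume "p \<in> quarter_disc n"
  then obtain a b where p: "p = (a, b)" "1 \<le> a" "a\<^sup>2 + b\<^sup>2 \<le> n" by (auto simp: quarter_disc_def)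
  then have "a\<^sup>2 < m\<^sup>2" "b\<^sup>2 < m\<^sup>2" using assms by linarith+
  then show "p \<in> {1..<m} \<times> {0..<m}" using p(1,2) by (auto dest: power2_less_imp_less)
qed

lemma finite_quarter_disc: "finite (quarter_disc n)"
proof -
  have "n < (Suc n)\<^sup>2" by (simp add: power2_eq_square)
  then show ?thesis by (rule finite_subset[OF quarter_disc_subset]) auto
qed

text \<open>
  Counting column by column bounds the number by \<open>\<pi> n / 4 + \<surd>n\<close>, where the second term accounts for
  the points on the axis. This is at most \<open>n\<close> as soon as \<open>\<surd>n \<ge> 5\<close>; the remaining values of \<open>n\<close> are
  checked by enumeration. The bound is attained at \<open>n = 1, 2, 5\<close>.
\<close>

lemma card_quarter_disc_le: "card (quarter_disc n) \<le> n"
proof (cases "n < 25")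
  case True
  have "\<forall>n\<in>set [0..<25]. length (filter (\<lambda>(a, b). a * a + b * b \<le> n) (List.product [1..<5] [0..<5])) \<le> n"
    by code_simp
  then have *: "length (filter (\<lambda>(a, b). a * a + b * b \<le> n) (List.product [1..<5] [0..<5])) \<le> n"
    using True by auto
  have "quarter_disc n \<subseteq> set (filter (\<lambda>(a, b). a * a + b * b \<le> n) (List.product [1..<5] [0..<5]))"
    using quarter_disc_subset[of n 5] True by (auto simp: quarter_disc_def power2_eq_square)
  then have "card (quarter_disc n) \<le> card (set (filter (\<lambda>(a, b). a * a + b * b \<le> n) (List.product [1..<5] [0..<5])))"
    by (intro card_mono) auto
  also have "\<dots> \<le> length (filter (\<lambda>(a, b). a * a + b * b \<le> n) (List.product [1..<5] [0..<5]))"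
    by (rule card_length)
  finally show ?thesis using * by linarith
next
  case False
  define r where "r = sqrt (real n)"
  have r2: "r\<^sup>2 = real n" by (simp add: r_def)
  have r5: "5 \<le> r" using False unfolding r_def by (intro real_le_rsqrt) auto
  define s where "s = nat \<lfloor>r\<rfloor>"
  have s: "real s \<le> r" using r5 by (simp add: s_def)
  define B where "B a = nat \<lfloor>sqrt (r\<^sup>2 - (real a)\<^sup>2)\<rfloor>" for a
  have "quarter_disc n \<subseteq> (SIGMA a:{1..s}. {0..B a})"
  proof
    fix p assume "p \<in> quarter_disc n"
    then obtain a b where p: "p = (a, b)" "1 \<le> a" "a\<^sup>2 + b\<^sup>2 \<le> n" by (auto simp: quarter_disc_def)
    have *: "(real a)\<^sup>2 + (real b)\<^sup>2 \<le> r\<^sup>2"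
      using of_nat_mono[OF p(3), where ?'a = real] by (simp add: r2)
    then have "(real a)\<^sup>2 \<le> r\<^sup>2" using zero_le_power2[of "real b"] by linarith
    then have "real a \<le> r" using r5 by (auto dest: power2_le_imp_le)
    then have "a \<le> s" unfolding s_def by (simp add: le_nat_floor)
    moreover have "b \<le> B a"
      unfolding B_def using * by (intro le_nat_floor real_le_rsqrt) simp
    ultimately show "p \<in> (SIGMA a:{1..s}. {0..B a})" using p by auto
  qed
  then have "card (quarter_disc n) \<le> card (SIGMA a:{1..s}. {0..B a})"
    by (rule card_mono[rotated]) (rule finite_SigmaI; simp)
  also have "card (SIGMA a:{1..s}. {0..B a}) = (\<Sum>a=1..s. B a + 1)"
    by simp
  finally have "real (card (quarter_disc n)) \<le> real (\<Sum>a=1..s. B a + 1)"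
    by (rule of_nat_mono)
  also have "\<dots> = (\<Sum>a=1..s. real (B a) + 1)"
    by (simp only: of_nat_sum of_nat_add of_nat_1)
  also have "\<dots> \<le> (\<Sum>a=1..s. sqrt (r\<^sup>2 - (real a)\<^sup>2) + 1)"
  proof (intro sum_mono add_right_mono)
    fix a assume "a \<in> {1..s}"
    then have "real a \<le> r" using s by auto
    then have "(real a)\<^sup>2 \<le> r\<^sup>2" by (intro power_mono) auto
    then show "real (B a) \<le> sqrt (r\<^sup>2 - (real a)\<^sup>2)" by (simp add: B_def)
  qed
  also have "\<dots> = (\<Sum>a=1..s. sqrt (r\<^sup>2 - (real a)\<^sup>2)) + real s"
    by (simp add: sum.distrib)
  also have "\<dots> \<le> pi * r\<^sup>2 / 4 + r"
    using sum_sqrt_le_quarter_disc[OF s] r5 s by simp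
  also have "\<dots> \<le> (16 / 5) * r\<^sup>2 / 4 + r * r / 5"
    using r5 pi_le_16_5 by (intro add_mono divide_right_mono mult_right_mono) auto
  also have "\<dots> = real n" using r2 by (simp add: power2_eq_square)
  finally show ?thesis by simp
qed

text \<open>
  A quarter turn permutes the lattice points of the disc, so the quadrant bound counts four times.
\<close>

lemma card_int_disc_le:
  "finite {(a::int, b::int). (a, b) \<noteq> (0, 0) \<and> a\<^sup>2 + b\<^sup>2 \<le> int n}" (is "finite ?D")
  "card {(a::int, b::int). (a, b) \<noteq> (0, 0) \<and> a\<^sup>2 + b\<^sup>2 \<le> int n} \<le> 4 * n"
proof -
  \<comment> \<open>\<open>q i\<close> is the rotation by \<open>i\<close> right angles.\<close>
  define q :: "nat \<Rightarrow> nat \<times> nat \<Rightarrow> int \<times> int" where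
    "q i = (\<lambda>(a, b). [(int a, int b), (- int b, int a), (- int a, - int b), (int b, - int a)] ! i)" for i
  have sub: "?D \<subseteq> (\<Union>i\<in>{..<4}. q i ` quarter_disc n)"
  proof
    fix p assume "p \<in> ?D"
    then obtain a b where p: "p = (a, b)" "(a, b) \<noteq> (0, 0)" "a\<^sup>2 + b\<^sup>2 \<le> int n" by auto
    have le: "(nat \<bar>a\<bar>)\<^sup>2 + (nat \<bar>b\<bar>)\<^sup>2 \<le> n"
    proof -
      have "int ((nat \<bar>a\<bar>)\<^sup>2 + (nat \<bar>b\<bar>)\<^sup>2) \<le> int n" using p(3) by simp
      then show ?thesis by linarith
    qed
    consider "a > 0" "b \<ge> 0" | "a \<le> 0" "b > 0" | "a < 0" "b \<le> 0" | "a \<ge> 0" "b < 0"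
      using p(2) by force
    then show "p \<in> (\<Union>i\<in>{..<4}. q i ` quarter_disc n)"
    proof cases
      case 1
      then have "(nat \<bar>a\<bar>, nat \<bar>b\<bar>) \<in> quarter_disc n" "p = q 0 (nat \<bar>a\<bar>, nat \<bar>b\<bar>)"
        using p le by (auto simp: quarter_disc_def q_def)
      then show ?thesis by (metis UN_iff imageI lessThan_iff zero_less_numeral)
    next
      case 2
      then have "(nat \<bar>b\<bar>, nat \<bar>a\<bar>) \<in> quarter_disc n" "p = q 1 (nat \<bar>b\<bar>, nat \<bar>a\<bar>)"
        using p le by (auto simp: quarter_disc_def q_def add.commute)
      then show ?thesis by (intro UN_I[of 1]) auto
    next
      case 3
      then have "(nat \<bar>a\<bar>, nat \<bar>b\<bar>) \<in> quarter_disc n" "p = q 2 (nat \<bar>a\<bar>, nat \<bar>b\<bar>)"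
        using p le by (auto simp: quarter_disc_def q_def)
      then show ?thesis by (intro UN_I[of 2]) auto
    next
      case 4
      then have "(nat \<bar>b\<bar>, nat \<bar>a\<bar>) \<in> quarter_disc n" "p = q 3 (nat \<bar>b\<bar>, nat \<bar>a\<bar>)"
        using p le by (auto simp: quarter_disc_def q_def add.commute)
      then show ?thesis by (intro UN_I[of 3]) auto
    qed
  qed
  have fin: "finite (\<Union>i\<in>{..<4::nat}. q i ` quarter_disc n)"
    using finite_quarter_disc by auto
  show "finite ?D" by (rule finite_subset[OF sub fin])
  have "card ?D \<le> card (\<Union>i\<in>{..<4}. q i ` quarter_disc n)"
    by (rule card_mono[OF fin sub])
  also have "\<dots> \<le> (\<Sum>i<4. card (q i ` quarter_disc n))"
    by (rule card_UN_le) simp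
  also have "\<dots> \<le> (\<Sum>i<4::nat. n)"
    by (intro sum_mono order_trans[OF card_image_le[OF finite_quarter_disc] card_quarter_disc_le])
  finally show "card ?D \<le> 4 * n" by simp
qed

section \<open>The energy above a varying frequency threshold\<close>

text \<open>
  The frequency \<open>0\<close> is left out: functions of zero average have no component there, and including it
  would spoil the bound linear in \<open>n\<close> on the number of frequencies.
\<close>

definition frequencies :: "nat \<Rightarrow> (int ^ 2) set" where
  "frequencies n = {k. k \<noteq> 0 \<and> (k $ 1)\<^sup>2 + (k $ 2)\<^sup>2 \<le> int n}"

lemma finite_frequencies: "finite (frequencies n)"
  and card_frequencies_le: "card (frequencies n) \<le> 4 * n"
proof -
  define D where "D = {(a::int, b::int). (a, b) \<noteq> (0, 0) \<and> a\<^sup>2 + b\<^sup>2 \<le> int n}"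
  have inj: "inj_on (\<lambda>k::int ^ 2. (k $ 1, k $ 2)) (frequencies n)"
    by (auto simp: inj_on_def vec_eq_iff forall_2)
  have sub: "(\<lambda>k::int ^ 2. (k $ 1, k $ 2)) ` frequencies n \<subseteq> D"
    by (auto simp: frequencies_def D_def vec_eq_iff forall_2)
  have D: "finite D" "card D \<le> 4 * n"
    unfolding D_def by (rule card_int_disc_le)+
  show "finite (frequencies n)" by (rule inj_on_finite[OF inj sub D(1)])
  show "card (frequencies n) \<le> 4 * n"
    using card_inj_on_le[OF inj sub D(1)] D(2) by linarith
qed

lemma sum_hartley_square_frequencies_le:
  "(\<Sum>k\<in>frequencies n. (hartley k x)\<^sup>2) \<le> real n / pi\<^sup>2"
proof -
  have "(\<Sum>k\<in>frequencies n. (hartley k x)\<^sup>2) = card (frequencies n) / (4 * pi\<^sup>2)"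
    by (rule sum_hartley_square[OF finite_frequencies]) (auto simp: frequencies_def)
  also have "\<dots> \<le> real (4 * n) / (4 * pi\<^sup>2)"
    by (intro divide_right_mono of_nat_mono card_frequencies_le) simp
  finally show ?thesis by simp
qed

text \<open>
  The summand is the energy of \<open>f\<close> in the frequencies with \<open>\<bar>k\<bar>\<^sup>2 > n\<close>. In the sum over \<open>n\<close> the frequency
  \<open>k\<close> occurs at most \<open>\<bar>k\<bar>\<^sup>2\<close> times, which produces the weight of the Dirichlet energy. Completeness
  is needed to know that nothing of \<open>f\<close> remains outside all frequencies.
\<close>

lemma sum_remainders_le:
  assumes f: "square_integrable torus f" and mean: "(\<integral>x. f x \<partial>torus) = 0"
    and g: "g \<in> L2_torus" "has_weak_gradient f g"
  shows "(\<Sum>n<M. (\<integral>x. (f x)\<^sup>2 \<partial>torus) - (\<Sum>k\<in>frequencies n. (\<integral>x. f x * hartley k x \<partial>torus)\<^sup>2))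
    \<le> (L2_norm g)\<^sup>2"
proof -
  define c where "c k = (\<integral>x. f x * hartley k x \<partial>torus)" for k
  define q where "q k = nat ((k $ 1)\<^sup>2 + (k $ 2)\<^sup>2)" for k :: "int ^ 2"
  have q: "int (q k) = (k $ 1)\<^sup>2 + (k $ 2)\<^sup>2" for k
    unfolding q_def by (rule nat_0_le) simp
  have c0: "c 0 = 0" using mean by (simp add: c_def hartley_def phase_def)
  have "(\<Sum>n<M. (\<integral>x. (f x)\<^sup>2 \<partial>torus) - (\<Sum>k\<in>frequencies n. (c k)\<^sup>2)) \<le> (L2_norm g)\<^sup>2 + e"
    if e: "0 < e" for e
  proof -
    \<comment> \<open>Completeness is applied once, but its error enters each of the \<open>M\<close> summands.\<close>
    define d where "d = e / (real M + 1)"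
    have d: "0 < d" using e by (simp add: d_def)
    obtain A where A: "finite A" "(\<integral>x. (f x)\<^sup>2 \<partial>torus) < (\<Sum>k\<in>A. (c k)\<^sup>2) + d"
      using hartley_complete[OF f d] unfolding c_def by blast
    have "(\<integral>x. (f x)\<^sup>2 \<partial>torus) - (\<Sum>k\<in>frequencies n. (c k)\<^sup>2)
        \<le> d + (\<Sum>k\<in>A. if n < q k then (c k)\<^sup>2 else 0)" for n
    proof -
      have "(\<Sum>k\<in>A. (c k)\<^sup>2)
          = (\<Sum>k\<in>A. if n < q k then (c k)\<^sup>2 else 0) + (\<Sum>k\<in>A. if n < q k then 0 else (c k)\<^sup>2)"
        unfolding sum.distrib[symmetric] by (rule sum.cong) auto
      also have "(\<Sum>k\<in>A. if n < q k then 0 else (c k)\<^sup>2) \<le> (\<Sum>k\<in>A \<inter> frequencies n. (c k)\<^sup>2)"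
        unfolding sum.inter_restrict[OF A(1)]
      proof (rule sum_mono)
        fix k assume "k \<in> A"
        have "k \<in> frequencies n" if "q k \<le> n" "k \<noteq> 0"
          using that unfolding frequencies_def mem_Collect_eq q[symmetric] by simp
        then consider "n < q k" | "k \<in> frequencies n" | "c k = 0" using c0 by (metis not_le)
        then show "(if n < q k then 0 else (c k)\<^sup>2) \<le> (if k \<in> frequencies n then (c k)\<^sup>2 else 0)"
          by cases simp_all
      qed
      also have "\<dots> \<le> (\<Sum>k\<in>frequencies n. (c k)\<^sup>2)"
        by (intro sum_mono2 finite_frequencies) auto
      finally show ?thesis using A(2) by linarith
    qed
    then have "(\<Sum>n<M. (\<integral>x. (f x)\<^sup>2 \<partial>torus) - (\<Sum>k\<in>frequencies n. (c k)\<^sup>2))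
        \<le> (\<Sum>n<M. d + (\<Sum>k\<in>A. if n < q k then (c k)\<^sup>2 else 0))"
      by (rule sum_mono)
    also have "\<dots> = real M * d + (\<Sum>k\<in>A. \<Sum>n<M. if n < q k then (c k)\<^sup>2 else 0)"
      by (subst sum.swap) (simp add: sum.distrib)
    also have "\<dots> \<le> e + (\<Sum>k\<in>A. of_int ((k $ 1)\<^sup>2 + (k $ 2)\<^sup>2) * (c k)\<^sup>2)"
    proof (intro add_mono sum_mono)
      have "real M * d \<le> (real M + 1) * d" using d by (intro mult_right_mono) auto
      also have "\<dots> = e" by (simp add: d_def)
      finally show "real M * d \<le> e" .
      fix k
      have "(\<Sum>n<M. if n < q k then (c k)\<^sup>2 else 0) = (\<Sum>n\<in>{..<M} \<inter> {..<q k}. (c k)\<^sup>2)"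
        by (simp only: sum.inter_restrict[OF finite_lessThan] lessThan_iff)
      also have "\<dots> = real (min M (q k)) * (c k)\<^sup>2"
      proof -
        have "{..<M} \<inter> {..<q k} = {..<min M (q k)}" by auto
        then show ?thesis by simp
      qed
      also have "\<dots> \<le> real (q k) * (c k)\<^sup>2"
        by (intro mult_right_mono) auto
      also have "real (q k) = of_int ((k $ 1)\<^sup>2 + (k $ 2)\<^sup>2)"
        by (simp only: q[symmetric] of_int_of_nat_eq)
      finally show "(\<Sum>n<M. if n < q k then (c k)\<^sup>2 else 0) \<le> of_int ((k $ 1)\<^sup>2 + (k $ 2)\<^sup>2) * (c k)\<^sup>2" .
    qed
    also have "\<dots> \<le> e + (L2_norm g)\<^sup>2"
      using weighted_Bessel_weak_gradient[OF g A(1)] by (simp add: c_def)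
    finally show ?thesis by (simp add: add.commute)
  qed
  then show ?thesis unfolding c_def by (rule field_le_epsilon)
qed

section \<open>The pointwise bound on the density\<close>

text \<open>
  The summand decreases in \<open>n\<close>, so the sum dominates the integral of \<open>(R - \<surd>t)\<^sup>2\<close> over \<open>[0, R\<^sup>2]\<close>, which
  is \<open>R\<^sup>4 (1 - 4/3 + 1/2)\<close>. The comparison is made through the primitive \<open>G\<close>.
\<close>

lemma fourth_power_le_sum_square_gaps:
  assumes R: "0 \<le> R" and M: "R\<^sup>2 \<le> real M"
  shows "R ^ 4 / 6 \<le> (\<Sum>n<M. (max 0 (R - sqrt (real n)))\<^sup>2)"
proof -
  define G where "G t = R\<^sup>2 * t - 4 / 3 * R * (t * sqrt t) + t\<^sup>2 / 2" for t
  \<comment> \<open>The primitive is stopped at \<open>R\<^sup>2\<close>, where the positive part of the gap becomes \<open>0\<close>.\<close>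
  define H where "H n = G (min (real n) (R\<^sup>2))" for n
  have G': "(G has_real_derivative (R - sqrt t)\<^sup>2) (at t)" if t: "0 < t" for t
  proof -
    have "(G has_real_derivative
        R\<^sup>2 - 4 / 3 * R * (sqrt t + t * (inverse (sqrt t) / 2)) + t) (at t)"
      unfolding G_def by (rule derivative_eq_intros refl | use t in \<open>simp; fail\<close>)+
    also have "t * (inverse (sqrt t) / 2) = sqrt t / 2"
    proof -
      have "w * w * (inverse w / 2) = w / 2" if "0 < w" for w :: real
        using that by simp
      from this[of "sqrt t"] show ?thesis using t by simp
    qed
    also have "R\<^sup>2 - 4 / 3 * R * (sqrt t + sqrt t / 2) + t = (R - sqrt t)\<^sup>2"
      using t by (simp add: power2_diff)
    finally show ?thesis .
  qed
  have cont: "continuous_on S G" for S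
    unfolding G_def by (auto intro!: continuous_intros)
  have step: "H (Suc n) - H n \<le> (max 0 (R - sqrt (real n)))\<^sup>2" for n
  proof (cases "real n \<le> R\<^sup>2")
    case False
    then show ?thesis by (simp add: H_def min_def)
  next
    case True
    define b where "b = min (real (Suc n)) (R\<^sup>2)"
    have nR: "sqrt (real n) \<le> R" using True R by (intro real_le_lsqrt) auto
    have "G b - G (real n) \<le> (R - sqrt (real n))\<^sup>2 * (b - real n)"
    proof (rule primitive_increment_bounds(2)[where f = "\<lambda>t. (R - sqrt t)\<^sup>2" and l = 0])
      show "real n \<le> b" using True by (simp add: b_def)
      fix t assume t: "real n < t" "t < b"
      show "(G has_real_derivative (R - sqrt t)\<^sup>2) (at t)"
        using t by (intro G') auto
      have "t \<le> R\<^sup>2" using t(2) by (simp add: b_def)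
      then have "sqrt t \<le> R" using R by (intro real_le_lsqrt) simp_all
      then show "0 \<le> (R - sqrt t)\<^sup>2 \<and> (R - sqrt t)\<^sup>2 \<le> (R - sqrt (real n))\<^sup>2"
        using t by (simp add: power_mono)
    qed (rule cont)
    also have "\<dots> \<le> (R - sqrt (real n))\<^sup>2 * 1"
      by (intro mult_left_mono) (auto simp: b_def)
    finally show ?thesis using True nR by (simp add: H_def b_def min_def max_def)
  qed
  have "R ^ 4 / 6 = H M - H 0"
  proof -
    have "H M = R\<^sup>2 * R\<^sup>2 - 4 / 3 * R * (R\<^sup>2 * R) + (R\<^sup>2)\<^sup>2 / 2"
      using M R by (simp add: H_def G_def min_def)
    also have "\<dots> = R ^ 4 / 6" by (simp add: power2_eq_square power4_eq_xxxx)
    finally show ?thesis by (simp add: H_def G_def)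
  qed
  also have "\<dots> = (\<Sum>n<M. H (Suc n) - H n)"
    by (rule sum_lessThan_telescope[symmetric])
  also have "\<dots> \<le> (\<Sum>n<M. (max 0 (R - sqrt (real n)))\<^sup>2)"
    by (intro sum_mono step)
  finally show ?thesis .
qed

text \<open>
  The triangle inequality for the Euclidean norm of the vectors \<open>u = (u - v) + v\<close>; the positive part
  is what survives squaring.
\<close>

lemma low_high_split:
  assumes low: "(\<Sum>j\<in>J. (v j)\<^sup>2) \<le> b"
  shows "(max 0 (sqrt (\<Sum>j\<in>J. (u j)\<^sup>2) - sqrt b))\<^sup>2 \<le> (\<Sum>j\<in>J. (u j - v j)\<^sup>2)"
proof -
  have "L2_set (\<lambda>j. (u j - v j) + v j) J \<le> L2_set (\<lambda>j. u j - v j) J + L2_set v J"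
    by (rule L2_set_triangle_ineq)
  moreover have "L2_set v J \<le> sqrt b" using low by (simp add: L2_set_def)
  ultimately have "L2_set u J - sqrt b \<le> L2_set (\<lambda>j. u j - v j) J"
    by simp
  then have "max 0 (sqrt (\<Sum>j\<in>J. (u j)\<^sup>2) - sqrt b) \<le> L2_set (\<lambda>j. u j - v j) J"
    by (simp add: L2_set_def[of u] L2_set_nonneg)
  then have "(max 0 (sqrt (\<Sum>j\<in>J. (u j)\<^sup>2) - sqrt b))\<^sup>2 \<le> (L2_set (\<lambda>j. u j - v j) J)\<^sup>2"
    by (rule power_mono) simp
  also have "\<dots> = (\<Sum>j\<in>J. (u j - v j)\<^sup>2)"
    unfolding L2_set_def by (rule real_sqrt_pow2) (simp add: sum_nonneg)
  finally show ?thesis .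
qed

text \<open>
  This is \<open>fourth_power_le_sum_square_gaps\<close> with \<open>R = \<pi> \<surd>r\<close>, scaled to the threshold \<open>n / \<pi>\<^sup>2\<close> that the
  lattice point bound provides.
\<close>

lemma square_le_sum_excess:
  assumes r: "0 \<le> r" and M: "pi\<^sup>2 * r \<le> real M"
  shows "r\<^sup>2 \<le> 6 / pi\<^sup>2 * (\<Sum>n<M. (max 0 (sqrt r - sqrt (real n / pi\<^sup>2)))\<^sup>2)"
proof -
  define R where "R = pi * sqrt r"
  have R: "0 \<le> R" "R\<^sup>2 = pi\<^sup>2 * r" using r by (simp_all add: R_def power_mult_distrib)
  have "max 0 (R - sqrt (real n)) = pi * max 0 (sqrt r - sqrt (real n / pi\<^sup>2))" for n
  proof -
    have "R - sqrt (real n) = pi * (sqrt r - sqrt (real n / pi\<^sup>2))"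
      by (simp add: R_def real_sqrt_divide right_diff_distrib)
    moreover have "max 0 (pi * y) = pi * max 0 y" for y
      by (simp add: max_def zero_le_mult_iff not_le)
    ultimately show ?thesis by simp
  qed
  then have "(\<Sum>n<M. (max 0 (R - sqrt (real n)))\<^sup>2)
      = pi\<^sup>2 * (\<Sum>n<M. (max 0 (sqrt r - sqrt (real n / pi\<^sup>2)))\<^sup>2)"
    by (simp add: power_mult_distrib sum_distrib_left)
  then have "R ^ 4 / 6 \<le> pi\<^sup>2 * (\<Sum>n<M. (max 0 (sqrt r - sqrt (real n / pi\<^sup>2)))\<^sup>2)"
    using fourth_power_le_sum_square_gaps[OF R(1), of M] M R(2) by simp
  moreover have "R ^ 4 = pi\<^sup>2 * (pi\<^sup>2 * r\<^sup>2)"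
    using arg_cong[OF R(2), of "\<lambda>t. t\<^sup>2"] by (simp add: power2_eq_square power4_eq_xxxx mult_ac)
  ultimately have "pi\<^sup>2 * (pi\<^sup>2 * r\<^sup>2 / 6) \<le> pi\<^sup>2 * (\<Sum>n<M. (max 0 (sqrt r - sqrt (real n / pi\<^sup>2)))\<^sup>2)"
    by simp
  then have "pi\<^sup>2 * r\<^sup>2 / 6 \<le> (\<Sum>n<M. (max 0 (sqrt r - sqrt (real n / pi\<^sup>2)))\<^sup>2)"
    by (rule mult_left_le_imp_le) simp
  then have "6 / pi\<^sup>2 * (pi\<^sup>2 * r\<^sup>2 / 6) \<le> 6 / pi\<^sup>2 * (\<Sum>n<M. (max 0 (sqrt r - sqrt (real n / pi\<^sup>2)))\<^sup>2)"
    by (rule mult_left_mono) simp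
  then show ?thesis by simp
qed

section \<open>The Lieb-Thirring inequality\<close>

theorem theorem2p4:
  fixes N :: nat
    and \<psi> :: "nat \<Rightarrow> real ^ 2 \<Rightarrow> real"
    and \<rho> :: "real ^ 2 \<Rightarrow> real"
  assumes "N \<ge> 1"
    and "\<And>j. j \<in> {1..N} \<Longrightarrow> \<psi> j \<in> H1_torus"
    and "\<And>j k. j \<in> {1..N} \<Longrightarrow> k \<in> {1..N} \<Longrightarrow>
           L2_inner (\<psi> j) (\<psi> k) = (if j = k then 1 else 0)"
    and "\<And>j. j \<in> {1..N} \<Longrightarrow> (\<integral>x. \<psi> j x \<partial>torus) = 0"
    and "\<And>x. \<rho> x = (\<Sum>j=1..N. (\<psi> j x)\<^sup>2)"
  shows "integrable torus (\<lambda>x. (\<rho> x)\<^sup>2) \<and>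
         (\<integral>x. (\<rho> x)\<^sup>2 \<partial>torus)
           \<le> 6 / pi\<^sup>2 * (\<Sum>j=1..N. (L2_norm (weak_gradient (\<psi> j)))\<^sup>2)"
proof -
  define S where "S = (\<Sum>j=1..N. (L2_norm (weak_gradient (\<psi> j)))\<^sup>2)"
  have S0: "0 \<le> S" by (simp add: S_def sum_nonneg)
  have \<psi>: "square_integrable torus (\<psi> j)" if "j \<in> {1..N}" for j
    using assms(2)[OF that] by (auto simp: H1_torus_def L2_torus_def square_integrable_def)
  have grad: "weak_gradient (\<psi> j) \<in> L2_torus \<and> has_weak_gradient (\<psi> j) (weak_gradient (\<psi> j))"
    if "j \<in> {1..N}" for j
  proof -
    have "\<exists>g. g \<in> L2_torus \<and> has_weak_gradient (\<psi> j) g"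
      using assms(2)[OF that] by (auto simp: H1_torus_def)
    then show ?thesis unfolding weak_gradient_def by (rule someI_ex)
  qed
  have ortho: "orthonormal_on torus {1..N} \<psi>"
    using \<psi> assms(3) by (simp add: orthonormal_on_def L2_inner_def)
  define c where "c j k = (\<integral>x. \<psi> j x * hartley k x \<partial>torus)" for j k
  define low where "low n j x = (\<Sum>k\<in>frequencies n. c j k * hartley k x)" for n j x
  define high where "high n x = (\<Sum>j=1..N. (\<psi> j x - low n j x)\<^sup>2)" for n x
  have H: "orthonormal_on torus (frequencies n) hartley" for n
    by (rule orthonormal_on_subset[OF orthonormal_hartley subset_UNIV])
  have high0: "0 \<le> high n x" for n x by (simp add: high_def sum_nonneg)
  have high_sq: "square_integrable torus (\<lambda>x. \<psi> j x - low n j x)" if "j \<in> {1..N}" for n j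
    unfolding low_def using H[of n] that
    by (intro square_integrable_diff \<psi> square_integrable_sum square_integrable_cmult)
       (auto simp: orthonormal_on_def)
  have high_int: "integrable torus (high n)" for n
    unfolding high_def using high_sq
    by (intro Bochner_Integration.integrable_sum) (simp add: square_integrable_def)
  have energy: "(\<Sum>n<M. \<integral>x. high n x \<partial>torus) \<le> S" for M
  proof -
    have "(\<integral>x. high n x \<partial>torus) = (\<Sum>j=1..N. (\<integral>x. (\<psi> j x)\<^sup>2 \<partial>torus) - (\<Sum>k\<in>frequencies n. (c j k)\<^sup>2))" for n
    proof -
      have "(\<integral>x. high n x \<partial>torus) = (\<Sum>j=1..N. \<integral>x. (\<psi> j x - low n j x)\<^sup>2 \<partial>torus)"
        unfolding high_def using high_sq
        by (intro Bochner_Integration.integral_sum) (simp add: square_integrable_def)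
      also have "\<dots> = (\<Sum>j=1..N. (\<integral>x. (\<psi> j x)\<^sup>2 \<partial>torus) - (\<Sum>k\<in>frequencies n. (c j k)\<^sup>2))"
        unfolding low_def c_def
        by (intro sum.cong refl integral_square_remainder finite_frequencies H \<psi>)
      finally show ?thesis .
    qed
    then have "(\<Sum>n<M. \<integral>x. high n x \<partial>torus)
        = (\<Sum>n<M. \<Sum>j=1..N. (\<integral>x. (\<psi> j x)\<^sup>2 \<partial>torus) - (\<Sum>k\<in>frequencies n. (c j k)\<^sup>2))"
      by (simp only:)
    also have "\<dots>
        = (\<Sum>j=1..N. \<Sum>n<M. (\<integral>x. (\<psi> j x)\<^sup>2 \<partial>torus) - (\<Sum>k\<in>frequencies n. (c j k)\<^sup>2))"
      by (rule sum.swap)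
    also have "\<dots> \<le> S"
      unfolding S_def c_def
    proof (rule sum_mono)
      fix j assume j: "j \<in> {1..N}"
      show "(\<Sum>n<M. (\<integral>x. (\<psi> j x)\<^sup>2 \<partial>torus) - (\<Sum>k\<in>frequencies n. (\<integral>x. \<psi> j x * hartley k x \<partial>torus)\<^sup>2))
          \<le> (L2_norm (weak_gradient (\<psi> j)))\<^sup>2"
        using sum_remainders_le[OF \<psi>[OF j] assms(4)[OF j]] grad[OF j] by blast
    qed
    finally show ?thesis .
  qed
  have \<rho>_le: "(\<rho> x)\<^sup>2 \<le> 6 / pi\<^sup>2 * (\<Sum>n<M. high n x)" if M: "pi\<^sup>2 * \<rho> x \<le> real M" for M x
  proof -
    have "(max 0 (sqrt (\<rho> x) - sqrt (real n / pi\<^sup>2)))\<^sup>2 \<le> high n x" for n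
      unfolding assms(5) high_def
    proof (rule low_high_split)
      have "(\<Sum>j=1..N. (low n j x)\<^sup>2) \<le> (\<Sum>k\<in>frequencies n. (hartley k x)\<^sup>2)"
        unfolding low_def c_def
        by (rule sum_square_projections_le[OF finite_frequencies H _ ortho]) simp
      also have "\<dots> \<le> real n / pi\<^sup>2" by (rule sum_hartley_square_frequencies_le)
      finally show "(\<Sum>j=1..N. (low n j x)\<^sup>2) \<le> real n / pi\<^sup>2" .
    qed
    then have "6 / pi\<^sup>2 * (\<Sum>n<M. (max 0 (sqrt (\<rho> x) - sqrt (real n / pi\<^sup>2)))\<^sup>2)
        \<le> 6 / pi\<^sup>2 * (\<Sum>n<M. high n x)"
      by (intro mult_left_mono sum_mono) auto
    moreover have "0 \<le> \<rho> x" by (simp add: assms(5) sum_nonneg)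
    ultimately show ?thesis using square_le_sum_excess[OF _ M] by linarith
  qed
  have "(\<integral>\<^sup>+x. ennreal ((\<rho> x)\<^sup>2) \<partial>torus) \<le> (\<integral>\<^sup>+x. (\<Sum>n. ennreal (6 / pi\<^sup>2 * high n x)) \<partial>torus)"
  proof (rule nn_integral_mono)
    fix x
    \<comment> \<open>The number of thresholds needed depends on \<open>x\<close>; the series over all thresholds serves every \<open>x\<close>.\<close>
    obtain M :: nat where "pi\<^sup>2 * \<rho> x \<le> real M" using real_arch_simple by blast
    from \<rho>_le[OF this] have "ennreal ((\<rho> x)\<^sup>2) \<le> ennreal (\<Sum>n<M. 6 / pi\<^sup>2 * high n x)"
      by (simp add: sum_distrib_left ennreal_leI)
    also have "\<dots> = (\<Sum>n<M. ennreal (6 / pi\<^sup>2 * high n x))"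
      using high0 by (simp add: sum_ennreal)
    also have "\<dots> \<le> (\<Sum>n. ennreal (6 / pi\<^sup>2 * high n x))"
      by (rule sum_le_suminf) auto
    finally show "ennreal ((\<rho> x)\<^sup>2) \<le> (\<Sum>n. ennreal (6 / pi\<^sup>2 * high n x))" .
  qed
  also have "\<dots> = (\<Sum>n. \<integral>\<^sup>+x. ennreal (6 / pi\<^sup>2 * high n x) \<partial>torus)"
    using high_int by (intro nn_integral_suminf) (auto intro: borel_measurable_integrable)
  also have "\<dots> = (\<Sum>n. ennreal (6 / pi\<^sup>2 * (\<integral>x. high n x \<partial>torus)))"
    using high_int high0 by (subst nn_integral_eq_integral) auto
  also have "\<dots> \<le> ennreal (6 / pi\<^sup>2 * S)"
  proof (rule suminf_le_const)
    fix M
    have "(\<Sum>n<M. ennreal (6 / pi\<^sup>2 * (\<integral>x. high n x \<partial>torus)))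
        = ennreal (6 / pi\<^sup>2 * (\<Sum>n<M. \<integral>x. high n x \<partial>torus))"
      using high0 by (simp add: sum_ennreal sum_distrib_left)
    also have "\<dots> \<le> ennreal (6 / pi\<^sup>2 * S)"
      by (intro ennreal_leI mult_left_mono energy) simp
    finally show "(\<Sum>n<M. ennreal (6 / pi\<^sup>2 * (\<integral>x. high n x \<partial>torus))) \<le> ennreal (6 / pi\<^sup>2 * S)" .
  qed simp
  finally have bound: "(\<integral>\<^sup>+x. ennreal ((\<rho> x)\<^sup>2) \<partial>torus) \<le> ennreal (6 / pi\<^sup>2 * S)" .
  have "\<rho> \<in> borel_measurable torus"
    unfolding assms(5)[abs_def] using \<psi>
    by (intro borel_measurable_sum borel_measurable_power) (auto simp: square_integrable_def)
  then have int: "integrable torus (\<lambda>x. (\<rho> x)\<^sup>2)"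
    using le_less_trans[OF bound ennreal_less_top] by (intro integrableI_bounded) simp_all
  then have "ennreal (\<integral>x. (\<rho> x)\<^sup>2 \<partial>torus) \<le> ennreal (6 / pi\<^sup>2 * S)"
    using bound nn_integral_eq_integral[OF int] by simp
  then have "(\<integral>x. (\<rho> x)\<^sup>2 \<partial>torus) \<le> 6 / pi\<^sup>2 * S"
    using S0 by (simp add: ennreal_le_iff)
  then show ?thesis using int by (simp add: S_def)
qed

end
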